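(* Let $f\in C_c^\infty(\mathbb R)$ be nonnegative and not identically zero, and let $c>0$. Consider the inviscid system $$u_t+Vu_x=2qu,\qquad q_t+Vq_x=q^2-\sigma u^2,\qquad V_x=2q,\quad V(0,t)=0$$ on $\mathbb R$ with the same initial data $q_0=cf$, $u_0=f$ for both $\sigma=c^2$ and $\sigma=-c^2$. (i) For $\sigma=c^2$, the corresponding solution is classical for every finite $t\ge0$ (i.e. there is a global classical solution). (ii) For $\sigma=-c^2$, the corresponding solution blows up exactly at time $$T_*=\frac{1}{2c\|f\|_\infty}.$$
   Context: The system is the $\nu=0$ whole-line form of $u_t+2\psi u_x=2\psi_xu$, $\omega_t+2\psi\omega_x=\sigma(u^2)_x$, $-\psi_{xx}=\omega$, with $q=\psi_x$, $V=2\psi$, where $u,q$ and their derivatives tend to zero as $|x|\to\infty$, $\psi$ may have finite, possibly different, limits at $\pm\infty$, and $\psi(0,t)=0$. "Classical" means smooth on $\mathbb R\times[0,T)$ with this decay. "Blows up at time $T_*$" means that the classical solution exists on $[0,T_* )$ and $\|q(t)+cu(t)\|_\infty+\|q(t)-cu(t)\|_\infty\to\infty$ as $t\uparrow T_*$. *)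

theory Defs
  imports "HOL-Analysis.Analysis"
begin

text \<open>Functions of space and time are written \<open>w x t\<close>. The time set \<open>I\<close> is
  \<open>{0..<T}\<close> or \<open>{0..}\<close>; time derivatives are taken within \<open>I\<close>, so they are
  one-sided at \<open>t = 0\<close>.\<close>

definition test_function :: "(real \<Rightarrow> real) \<Rightarrow> bool" where
  "test_function f \<longleftrightarrow>
     (\<forall>n x. (deriv ^^ n) f differentiable (at x)) \<and> compact (closure {x. f x \<noteq> 0})"

text \<open>Meaningful for bounded functions only (real-valued supremum).\<close>
definition sup_norm :: "(real \<Rightarrow> real) \<Rightarrow> real" where
  "sup_norm g = (SUP x. \<bar>g x\<bar>)"

definition dx :: "(real \<Rightarrow> real \<Rightarrow> real) \<Rightarrow> real \<Rightarrow> real \<Rightarrow> real" where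
  "dx w x t = deriv (\<lambda>y. w y t) x"

definition dt :: "real set \<Rightarrow> (real \<Rightarrow> real \<Rightarrow> real) \<Rightarrow> real \<Rightarrow> real \<Rightarrow> real" where
  "dt I w x t = vector_derivative (\<lambda>s. w x s) (at t within I)"

text \<open>\<open>D i j\<close> is the partial derivative of \<open>w\<close> of order \<open>i\<close> in space and \<open>j\<close> in time; on
  \<open>UNIV \<times> I\<close> it is uniquely determined by \<open>w\<close>.\<close>
definition partials_of ::
  "real set \<Rightarrow> (real \<Rightarrow> real \<Rightarrow> real) \<Rightarrow> (nat \<Rightarrow> nat \<Rightarrow> real \<Rightarrow> real \<Rightarrow> real) \<Rightarrow> bool" where
  "partials_of I w D \<longleftrightarrow>
     (\<forall>x. \<forall>t\<in>I. D 0 0 x t = w x t) \<and>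
     (\<forall>i j. continuous_on (UNIV \<times> I) (\<lambda>(x, t). D i j x t)) \<and>
     (\<forall>i j x. \<forall>t\<in>I.
        ((\<lambda>y. D i j y t) has_real_derivative D (Suc i) j x t) (at x) \<and>
        ((\<lambda>s. D i j x s) has_real_derivative D i (Suc j) x t) (at t within I))"

definition smooth_on_strip :: "real set \<Rightarrow> (real \<Rightarrow> real \<Rightarrow> real) \<Rightarrow> bool" where
  "smooth_on_strip I w \<longleftrightarrow> (\<exists>D. partials_of I w D)"

definition smooth_decaying_on_strip :: "real set \<Rightarrow> (real \<Rightarrow> real \<Rightarrow> real) \<Rightarrow> bool" where
  "smooth_decaying_on_strip I w \<longleftrightarrow>
     (\<exists>D. partials_of I w D \<and> (\<forall>i j. \<forall>t\<in>I. ((\<lambda>x. D i j x t) \<longlongrightarrow> 0) at_infinity))"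

text \<open>Here \<open>V = 2\<psi>\<close>, so the finite limits of \<open>\<psi>\<close> at both ends are those of \<open>V\<close>.\<close>
definition classical_solution ::
  "real \<Rightarrow> (real \<Rightarrow> real) \<Rightarrow> (real \<Rightarrow> real) \<Rightarrow> real set \<Rightarrow>
   (real \<Rightarrow> real \<Rightarrow> real) \<Rightarrow> (real \<Rightarrow> real \<Rightarrow> real) \<Rightarrow> (real \<Rightarrow> real \<Rightarrow> real) \<Rightarrow> bool" where
  "classical_solution \<sigma> u0 q0 I u q V \<longleftrightarrow>
     smooth_decaying_on_strip I u \<and> smooth_decaying_on_strip I q \<and> smooth_on_strip I V \<and>
     (\<forall>t\<in>I. (\<exists>l. ((\<lambda>x. V x t) \<longlongrightarrow> l) at_bot) \<and> (\<exists>l. ((\<lambda>x. V x t) \<longlongrightarrow> l) at_top)) \<and>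
     (\<forall>x. \<forall>t\<in>I.
        dt I u x t + V x t * dx u x t = 2 * q x t * u x t \<and>
        dt I q x t + V x t * dx q x t = (q x t)\<^sup>2 - \<sigma> * (u x t)\<^sup>2 \<and>
        dx V x t = 2 * q x t) \<and>
     (\<forall>t\<in>I. V 0 t = 0) \<and>
     (\<forall>x. u x 0 = u0 x \<and> q x 0 = q0 x)"

definition global_classical_solution ::
  "real \<Rightarrow> (real \<Rightarrow> real) \<Rightarrow> (real \<Rightarrow> real) \<Rightarrow>
   (real \<Rightarrow> real \<Rightarrow> real) \<Rightarrow> (real \<Rightarrow> real \<Rightarrow> real) \<Rightarrow> (real \<Rightarrow> real \<Rightarrow> real) \<Rightarrow> bool" where
  "global_classical_solution \<sigma> u0 q0 u q V \<longleftrightarrow> classical_solution \<sigma> u0 q0 {0..} u q V"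

text \<open>The solution with the given data exists on \<open>[0, T)\<close>, and its norm diverges at \<open>T\<close>.
  Divergence is required of every classical solution with these data, so that the notion
  does not depend on a choice of solution.\<close>
definition blows_up_at ::
  "real \<Rightarrow> real \<Rightarrow> (real \<Rightarrow> real) \<Rightarrow> (real \<Rightarrow> real) \<Rightarrow> real \<Rightarrow> bool" where
  "blows_up_at c \<sigma> u0 q0 T \<longleftrightarrow>
     0 < T \<and>
     (\<exists>u q V. classical_solution \<sigma> u0 q0 {0..<T} u q V) \<and>
     (\<forall>u q V. classical_solution \<sigma> u0 q0 {0..<T} u q V \<longrightarrow>
        filterlim (\<lambda>t. sup_norm (\<lambda>x. q x t + c * u x t) + sup_norm (\<lambda>x. q x t - c * u x t))
          at_top (at_left T))"

end

theory Submission
  imports Defs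
begin

text \<open>Let \<open>X(a, t)\<close> be the flow of \<open>V\<close>, with label \<open>a\<close>, and let \<open>Q\<close>, \<open>U\<close> be \<open>q\<close>, \<open>u\<close> along
  it. Since \<open>V\<^sub>x = 2 q\<close>, the Jacobian \<open>J = X\<^sub>a\<close> satisfies \<open>J\<^sub>t = 2 Q J\<close>, and the system becomes
  \<open>U\<^sub>t = 2 Q U\<close>, \<open>Q\<^sub>t = Q\<^sup>2 - \<sigma> U\<^sup>2\<close>: one ordinary differential equation for each label.
  In particular \<open>U = f J\<close>.

  For \<open>\<sigma> = -c\<^sup>2\<close> both \<open>Q + c U\<close> and \<open>Q - c U\<close> solve \<open>z' = z\<^sup>2\<close>. The data make the second one
  vanish and the first one equal to \<open>2 c f / (1 - 2 c f t)\<close>, which explodes first at a label where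
  \<open>f\<close> is maximal. For \<open>\<sigma> = c\<^sup>2\<close> it is the complex number \<open>Z = Q + i c U\<close> that solves \<open>Z' = Z\<^sup>2\<close>.
  Now \<open>Z\<^sub>0 = (1 + i) c f\<close> is not real unless it is zero, so the denominator
  \<open>\<bar>1 - Z\<^sub>0 t\<bar>\<^sup>2 = (1 - c f t)\<^sup>2 + (c f t)\<^sup>2\<close> of \<open>Z = Z\<^sub>0 / (1 - Z\<^sub>0 t)\<close> has no zero and the
  solution is global. In both cases \<open>J\<close> is the reciprocal of the denominator.

  Existence then amounts to the passage from such explicit profiles in the label \<open>a\<close> back to the
  position \<open>x\<close> (theorem \<open>classical_solution_eulerian\<close>). The flow is the integral of \<open>J\<close> over
  \<open>[0, a]\<close>, and it is inverted by the inverse function theorem. Partial derivatives of every order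
  are obtained without computing them: a family of functions in which every member has continuous
  partial derivatives that belong to the family again consists of smooth functions
  (\<open>partials_closed_imp_partials_of\<close>), and the functions \<open>G(A(x, t), t)\<close>, with \<open>G\<close> smooth and
  \<open>A\<close> the inverse flow, form such a family. Those whose \<open>G\<close> vanishes for large labels form a
  smaller one, which yields the decay.

  Blow-up concerns every classical solution, so the explicit values have to be recovered from an
  arbitrary one (\<open>classical_solution_along_flow\<close>). That solution is compared with the profiles
  along the explicit flow, on a bounded interval of labels containing \<open>0\<close>. Because \<open>V\<close> vanishes at
  the origin, the difference of the velocities at label \<open>a\<close> is an integral over labels between \<open>0\<close>
  and \<open>a\<close>, and the interval is closed under the estimate; Gronwall's argument
  (\<open>gronwall_family\<close>) concludes. At the label where \<open>f\<close> is maximal this gives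
  \<open>q + c u = 1 / (T - t)\<close>, with \<open>T\<close> the blow-up time.\<close>

section \<open>Families of functions closed under partial derivatives\<close>

definition has_partials ::
  "real set \<Rightarrow> (real \<Rightarrow> real \<Rightarrow> real) \<Rightarrow> (real \<Rightarrow> real \<Rightarrow> real) \<Rightarrow> (real \<Rightarrow> real \<Rightarrow> real) \<Rightarrow> bool" where
  "has_partials I w wx wt \<longleftrightarrow>
     continuous_on (UNIV \<times> I) (\<lambda>(x, t). w x t) \<and>
     (\<forall>x. \<forall>t\<in>I. ((\<lambda>y. w y t) has_real_derivative wx x t) (at x) \<and>
                 ((\<lambda>s. w x s) has_real_derivative wt x t) (at t))"

lemma has_partialsD:
  assumes "has_partials I w wx wt"
  shows "continuous_on (UNIV \<times> I) (\<lambda>(x, t). w x t)"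
    and "t \<in> I \<Longrightarrow> ((\<lambda>y. w y t) has_real_derivative wx x t) (at x)"
    and "t \<in> I \<Longrightarrow> ((\<lambda>s. w x s) has_real_derivative wt x t) (at t)"
  using assms unfolding has_partials_def by blast+

lemma continuous_on_strip_compose:
  assumes "continuous_on (UNIV \<times> I) (\<lambda>(x, t). w x t)"
    and "continuous_on S g" "continuous_on S \<tau>" "\<And>p. p \<in> S \<Longrightarrow> \<tau> p \<in> I"
  shows "continuous_on S (\<lambda>p. w (g p) (\<tau> p))"
proof -
  have "continuous_on S (\<lambda>p. (g p, \<tau> p))"
    using assms(2,3) by (rule continuous_on_Pair)
  from continuous_on_compose2[OF assms(1) this] show ?thesis
    using assms(4) by (simp add: image_subset_iff)
qed

text \<open>Differentiating \<open>w(y, t) - w(x - 1, t)\<close>, the integral of \<open>w\<^sub>x\<close>, under the integral sign in \<open>t\<close>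
  expresses \<open>w\<^sub>t(y, t) - w\<^sub>t(x - 1, t)\<close> as an integral of \<open>w\<^sub>x\<^sub>t\<close>; the fundamental theorem of calculus in \<open>y\<close> gives
  \<open>w\<^sub>t\<^sub>x = w\<^sub>x\<^sub>t\<close>.\<close>
lemma mixed_partials_commute:
  fixes I :: "real set"
  assumes I: "open I" "convex I" and t: "t \<in> I"
    and w: "has_partials I w wx wt"
    and wx: "has_partials I wx wxx wxt"
    and wt: "has_partials I wt wtx wtt"
    and cont: "continuous_on (UNIV \<times> I) (\<lambda>(x, t). wxt x t)"
  shows "wtx x t = wxt x t"
proof -
  have contc: "continuous_on (I \<times> cbox a b) (\<lambda>(s, y). wxt y s)" for a b
  proof -
    have "continuous_on (I \<times> cbox a b) (\<lambda>p. (snd p, fst p))"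
      by (intro continuous_intros)
    from continuous_on_compose2[OF cont this] show ?thesis
      by (simp add: case_prod_beta image_subset_iff mem_Times_iff)
  qed
  have ftc: "integral (cbox (x - 1) y) (\<lambda>z. wx z s) = w y s - w (x - 1) s"
    if "x - 1 \<le> y" "s \<in> I" for y s
  proof -
    have "((\<lambda>z. wx z s) has_integral w y s - w (x - 1) s) {x - 1..y}"
      by (rule fundamental_theorem_of_calculus[OF that(1)])
         (simp add: has_real_derivative_iff_has_vector_derivative[symmetric]
           has_field_derivative_at_within has_partialsD(2)[OF w that(2)])
    then show ?thesis by (simp add: integral_unique)
  qed
  have leib: "wt y t - wt (x - 1) t = integral {x - 1..y} (\<lambda>z. wxt z t)" if "x - 1 \<le> y" for y
  proof -
    have "((\<lambda>s. integral (cbox (x - 1) y) (\<lambda>z. wx z s)) has_field_derivative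
        integral (cbox (x - 1) y) (\<lambda>z. wxt z t)) (at t within I)"
    proof (rule leibniz_rule_field_derivative[OF _ _ contc t I(2)])
      show "((\<lambda>s. wx z s) has_field_derivative wxt z s) (at s within I)" if "s \<in> I" for z s
        using has_partialsD(3)[OF wx that] by (rule has_field_derivative_at_within)
      show "(\<lambda>z. wx z s) integrable_on cbox (x - 1) y" if "s \<in> I" for s
        by (rule integrable_continuous)
           (rule continuous_on_strip_compose[OF has_partialsD(1)[OF wx] continuous_on_id continuous_on_const that])
    qed
    then have "((\<lambda>s. w y s - w (x - 1) s) has_field_derivative
        integral (cbox (x - 1) y) (\<lambda>z. wxt z t)) (at t within I)"
      by (rule has_field_derivative_transform_within[OF _ zero_less_one t]) (use ftc that in simp)
    moreover have "((\<lambda>s. w y s - w (x - 1) s) has_field_derivative wt y t - wt (x - 1) t) (at t)"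
      by (intro derivative_intros has_partialsD(3)[OF w] t)
    ultimately have "wt y t - wt (x - 1) t = integral (cbox (x - 1) y) (\<lambda>z. wxt z t)"
      unfolding at_within_open[OF t I(1)] by (rule DERIV_unique[rotated])
    then show ?thesis by simp
  qed
  have "((\<lambda>y. integral {x - 1..y} (\<lambda>z. wxt z t)) has_real_derivative wxt x t)
      (at x within {x - 1..x + 1})"
    by (intro integral_has_real_derivative continuous_on_strip_compose[OF cont _ _ t] continuous_intros) auto
  then have "((\<lambda>y. wt y t - wt (x - 1) t) has_real_derivative wxt x t) (at x within {x - 1..x + 1})"
    by (rule has_field_derivative_transform_within[OF _ zero_less_one]) (auto simp: leib)
  moreover have "at x within {x - 1..x + 1} = at x"
    by (intro at_within_interior) auto
  moreover have "((\<lambda>y. wt y t - wt (x - 1) t) has_real_derivative wtx x t - 0) (at x)"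
    by (intro derivative_intros has_partialsD(2)[OF wt] t)
  ultimately have "wxt x t = wtx x t - 0"
    by (metis DERIV_unique)
  then show ?thesis by simp
qed

definition partials_closed :: "real set \<Rightarrow> (real \<Rightarrow> real \<Rightarrow> real) set \<Rightarrow> bool" where
  "partials_closed I F \<longleftrightarrow> (\<forall>w\<in>F. \<exists>wx\<in>F. \<exists>wt\<in>F. has_partials I w wx wt)"

text \<open>Choose in the family a space derivative and a time derivative of each member, and iterate the
  two choices. The family of derivatives so obtained has to be consistent in both indices, and this is
  where the symmetry of mixed derivatives enters. That all derivatives stay in the family is what
  later turns a common property of its members, such as decay, into a property of all derivatives.\<close>
lemma partials_closed_imp_partials_of:
  fixes I :: "real set"
  assumes I: "open I" "convex I" and F: "partials_closed I F" and w: "w \<in> F"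
  obtains D where "partials_of I w D" "\<And>i j. D i j \<in> F"
proof -
  obtain X T where XT: "\<And>w. w \<in> F \<Longrightarrow> X w \<in> F \<and> T w \<in> F \<and> has_partials I w (X w) (T w)"
    using F unfolding partials_closed_def by metis
  have iter: "(T ^^ j) v \<in> F" "(X ^^ j) v \<in> F" if "v \<in> F" for j v
    using that XT by (induction j) auto
  have comm: "X ((T ^^ j) v) x t = (T ^^ j) (X v) x t" if "v \<in> F" "t \<in> I" for j v x t
    using that(2)
  proof (induction j arbitrary: t)
    case (Suc j)
    let ?u = "(T ^^ j) v"
    have u: "?u \<in> F" "(T ^^ j) (X v) \<in> F" using iter that XT by auto
    have hp: "has_partials I v (X v) (T v)" if "v \<in> F" for v
      using XT[OF that] by blast
    have xu: "X ?u \<in> F" "T ?u \<in> F" "T (X ?u) \<in> F"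
      using XT u(1) by blast+
    have c: "X (T ?u) x t = T (X ?u) x t"
      by (rule mixed_partials_commute[OF I Suc.prems hp[OF u(1)] hp[OF xu(1)] hp[OF xu(2)]
            has_partialsD(1)[OF hp[OF xu(3)]]])
    have "((\<lambda>s. X ?u x s) has_real_derivative T (X ?u) x t) (at t)"
      by (rule has_partialsD(3)[OF hp[OF xu(1)] Suc.prems])
    then have "((\<lambda>s. (T ^^ j) (X v) x s) has_real_derivative T (X ?u) x t) (at t)"
      using Suc.IH unfolding at_within_open[OF Suc.prems I(1), symmetric]
      by (rule has_field_derivative_transform_within[OF _ zero_less_one Suc.prems])
    moreover have "((\<lambda>s. (T ^^ j) (X v) x s) has_real_derivative T ((T ^^ j) (X v)) x t) (at t)"
      by (rule has_partialsD(3)[OF hp[OF u(2)] Suc.prems])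
    ultimately have "T (X ?u) x t = T ((T ^^ j) (X v)) x t"
      by (rule DERIV_unique)
    with c show ?case by simp
  qed auto
  \<comment> \<open>Time derivatives are taken last, so that only the space derivative of \<open>D i j\<close> needs commutation.\<close>
  define D where "D = (\<lambda>i j. (T ^^ j) ((X ^^ i) w))"
  have D: "D i j \<in> F" for i j using iter w by (simp add: D_def)
  have "partials_of I w D"
    unfolding partials_of_def
  proof (intro conjI allI ballI)
    fix i j x t assume t: "t \<in> I"
    have "X (D i j) x t = D (Suc i) j x t"
      using comm[OF iter(2)[OF w] t] by (simp add: D_def)
    then show "((\<lambda>y. D i j y t) has_real_derivative D (Suc i) j x t) (at x)"
      using has_partialsD(2)[of I "D i j", OF _ t] XT[OF D] by metis
    show "((\<lambda>s. D i j x s) has_real_derivative D i (Suc j) x t) (at t within I)"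
      using has_partialsD(3)[of I "D i j", OF _ t] XT[OF D, of i j]
      by (auto simp: D_def intro: has_field_derivative_at_within)
  next
    show "continuous_on (UNIV \<times> I) (\<lambda>(x, t). D i j x t)" for i j
      using XT[OF D] has_partialsD(1) by blast
  qed (simp add: D_def)
  with D that show thesis by blast
qed

section \<open>The algebra of smooth functions on a strip\<close>

lemma partials_of_shift:
  "partials_of I w D \<Longrightarrow> partials_of I (D i j) (\<lambda>k l. D (i + k) (j + l))"
  by (simp add: partials_of_def)

lemma partials_of_subset:
  assumes "partials_of I w D" "K \<subseteq> I"
  shows "partials_of K w D"
  unfolding partials_of_def
proof (intro conjI allI ballI)
  show "continuous_on (UNIV \<times> K) (\<lambda>(x, t). D i j x t)" for i j
  proof (rule continuous_on_subset)
    show "continuous_on (UNIV \<times> I) (\<lambda>(x, t). D i j x t)"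
      using assms(1) by (simp add: partials_of_def)
  qed (use assms(2) in auto)
  fix x t assume "t \<in> K"
  then have t: "t \<in> I" using assms by auto
  show "D 0 0 x t = w x t"
    using assms t by (auto simp: partials_of_def)
  fix i j
  show "((\<lambda>y. D i j y t) has_real_derivative D (Suc i) j x t) (at x)"
    using assms t unfolding partials_of_def by blast
  have "((\<lambda>s. D i j x s) has_real_derivative D i (Suc j) x t) (at t within I)"
    using assms t unfolding partials_of_def by blast
  then show "((\<lambda>s. D i j x s) has_real_derivative D i (Suc j) x t) (at t within K)"
    using assms(2) by (rule DERIV_subset)
qed

lemma smooth_has_partials:
  assumes "open I" "smooth_on_strip I w"
  obtains wx wt where "has_partials I w wx wt" "smooth_on_strip I wx" "smooth_on_strip I wt"
proof -
  obtain D where D: "partials_of I w D"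
    using assms by (auto simp: smooth_on_strip_def)
  have eq: "w x t = D 0 0 x t" if "t \<in> I" for x t
    using D that by (simp add: partials_of_def)
  have "has_partials I w (D 1 0) (D 0 1)"
    unfolding has_partials_def
  proof (intro conjI allI ballI)
    have "continuous_on (UNIV \<times> I) (\<lambda>(x, t). D 0 0 x t)"
      using D by (simp add: partials_of_def)
    then show "continuous_on (UNIV \<times> I) (\<lambda>(x, t). w x t)"
      by (rule continuous_on_eq) (auto simp: eq)
  next
    fix x t assume t: "t \<in> I"
    have "((\<lambda>y. D 0 0 y t) has_real_derivative D (Suc 0) 0 x t) (at x)"
      using D t unfolding partials_of_def by blast
    then show "((\<lambda>y. w y t) has_real_derivative D 1 0 x t) (at x)"
      using eq[OF t] by simp
    have "((\<lambda>s. D 0 0 x s) has_real_derivative D 0 (Suc 0) x t) (at t within I)"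
      using D t unfolding partials_of_def by blast
    then have "((\<lambda>s. w x s) has_real_derivative D 0 (Suc 0) x t) (at t within I)"
      by (rule has_field_derivative_transform_within[OF _ zero_less_one t]) (simp add: eq)
    then show "((\<lambda>s. w x s) has_real_derivative D 0 1 x t) (at t)"
      unfolding at_within_open[OF t assms(1)] by simp
  qed
  moreover have "smooth_on_strip I (D 1 0)" "smooth_on_strip I (D 0 1)"
    using partials_of_shift[OF D] by (auto simp: smooth_on_strip_def)
  ultimately show thesis using that by blast
qed

lemma smooth_continuous:
  "smooth_on_strip I w \<Longrightarrow> continuous_on (UNIV \<times> I) (\<lambda>(x, t). w x t)"
proof -
  assume "smooth_on_strip I w"
  then obtain D where D: "partials_of I w D"
    by (auto simp: smooth_on_strip_def)
  then have "continuous_on (UNIV \<times> I) (\<lambda>(x, t). D 0 0 x t)"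
    by (auto simp: partials_of_def)
  then show ?thesis
    by (rule continuous_on_eq) (use D in \<open>auto simp: partials_of_def\<close>)
qed

text \<open>The algebra (without a unit) generated by a set of functions. If the partial derivatives of the
  generators lie in it, then by the product rule it is closed under partial derivatives.\<close>
inductive_set gen_alg :: "(real \<Rightarrow> real \<Rightarrow> real) set \<Rightarrow> (real \<Rightarrow> real \<Rightarrow> real) set"
  for B where
  base: "w \<in> B \<Longrightarrow> w \<in> gen_alg B"
| add: "v \<in> gen_alg B \<Longrightarrow> w \<in> gen_alg B \<Longrightarrow> (\<lambda>x t. v x t + w x t) \<in> gen_alg B"
| mult: "v \<in> gen_alg B \<Longrightarrow> w \<in> gen_alg B \<Longrightarrow> (\<lambda>x t. v x t * w x t) \<in> gen_alg B"

text \<open>To prove a function smooth it suffices to express its first partial derivatives as polynomials in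
  the function itself and in functions known to be smooth. Sums, products and reciprocals follow.\<close>
lemma smooth_by_generators:
  fixes I :: "real set"
  assumes I: "open I" "convex I"
    and B: "\<And>b. b \<in> B \<Longrightarrow> \<exists>bx\<in>gen_alg (B \<union> Collect (smooth_on_strip I)).
      \<exists>bt\<in>gen_alg (B \<union> Collect (smooth_on_strip I)). has_partials I b bx bt"
    and w: "w \<in> gen_alg (B \<union> Collect (smooth_on_strip I))"
  shows "smooth_on_strip I w"
proof -
  let ?A = "gen_alg (B \<union> Collect (smooth_on_strip I))"
  have "\<exists>wx\<in>?A. \<exists>wt\<in>?A. has_partials I w wx wt" if "w \<in> ?A" for w
    using that
  proof induction
    case (base w)
    then show ?case
      using B smooth_has_partials[OF I(1), of w] by (metis Un_iff gen_alg.base mem_Collect_eq)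
  next
    case (add v w)
    then obtain vx vt wx wt where mem: "vx \<in> ?A" "vt \<in> ?A" "wx \<in> ?A" "wt \<in> ?A"
      and v: "has_partials I v vx vt" and w: "has_partials I w wx wt" by blast
    have "has_partials I (\<lambda>x t. v x t + w x t) (\<lambda>x t. vx x t + wx x t) (\<lambda>x t. vt x t + wt x t)"
      unfolding has_partials_def
      using has_partialsD[OF v] has_partialsD[OF w]
      by (auto simp: case_prod_beta intro!: continuous_intros derivative_intros)
    then show ?case using mem gen_alg.add by blast
  next
    case (mult v w)
    then obtain vx vt wx wt where mem: "vx \<in> ?A" "vt \<in> ?A" "wx \<in> ?A" "wt \<in> ?A"
      and v: "has_partials I v vx vt" and w: "has_partials I w wx wt" by blast
    have "has_partials I (\<lambda>x t. v x t * w x t) (\<lambda>x t. v x t * wx x t + vx x t * w x t)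
        (\<lambda>x t. v x t * wt x t + vt x t * w x t)"
      unfolding has_partials_def
      using has_partialsD[OF v] has_partialsD[OF w]
      by (auto simp: case_prod_beta intro!: continuous_intros derivative_eq_intros)
    moreover have "(\<lambda>x t. v x t * wx x t + vx x t * w x t) \<in> ?A"
      "(\<lambda>x t. v x t * wt x t + vt x t * w x t) \<in> ?A"
      using mem mult by (auto intro: gen_alg.add gen_alg.mult)
    ultimately show ?case by blast
  qed
  then have "partials_closed I ?A" by (auto simp: partials_closed_def)
  from partials_closed_imp_partials_of[OF I this w] obtain D where "partials_of I w D"
    by blast
  then show ?thesis by (auto simp: smooth_on_strip_def)
qed

lemma smooth_add:
  assumes I: "open I" "convex I" and "smooth_on_strip I v" "smooth_on_strip I w"
  shows "smooth_on_strip I (\<lambda>x t. v x t + w x t)"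
proof (rule smooth_by_generators[of I "{}", OF I])
  show "(\<lambda>x t. v x t + w x t) \<in> gen_alg ({} \<union> Collect (smooth_on_strip I))"
    using assms(3,4) by (intro gen_alg.add gen_alg.base) auto
qed simp

lemma smooth_mult:
  assumes I: "open I" "convex I" and "smooth_on_strip I v" "smooth_on_strip I w"
  shows "smooth_on_strip I (\<lambda>x t. v x t * w x t)"
proof (rule smooth_by_generators[of I "{}", OF I])
  show "(\<lambda>x t. v x t * w x t) \<in> gen_alg ({} \<union> Collect (smooth_on_strip I))"
    using assms(3,4) by (intro gen_alg.mult gen_alg.base) auto
qed simp

lemma smooth_const: "smooth_on_strip I (\<lambda>x t. k)"
  unfolding smooth_on_strip_def
  by (rule exI[of _ "\<lambda>i j x t. if i = 0 \<and> j = 0 then k else 0"])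
     (auto simp: partials_of_def)

lemma smooth_time: "smooth_on_strip I (\<lambda>x t. t)"
  unfolding smooth_on_strip_def
proof (rule exI)
  let ?D = "\<lambda>i j (x::real) t. if i = 0 \<and> j = 0 then t else if i = 0 \<and> j = (1::nat) then 1 else 0 :: real"
  have "continuous_on (UNIV \<times> I) (\<lambda>(x, t). ?D i j x t)" for i j :: nat
  proof (cases "i = 0 \<and> j = 0")
    case True
    then show ?thesis by (simp add: case_prod_beta continuous_on_snd)
  next
    case False
    then have "(\<lambda>(x, t). ?D i j x t) = (\<lambda>_. if i = 0 \<and> j = 1 then 1 else 0)" by auto
    then show ?thesis by (simp only: continuous_on_const)
  qed
  then show "partials_of I (\<lambda>x t. t) ?D"
    unfolding partials_of_def by auto
qed

lemma smooth_position: "smooth_on_strip I (\<lambda>x t. x)"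
  unfolding smooth_on_strip_def
proof (rule exI)
  let ?D = "\<lambda>i j x (t::real). if i = 0 \<and> j = 0 then x else if i = (1::nat) \<and> j = 0 then 1 else 0 :: real"
  have "continuous_on (UNIV \<times> I) (\<lambda>(x, t). ?D i j x t)" for i j :: nat
  proof (cases "i = 0 \<and> j = 0")
    case True
    then show ?thesis by (simp add: case_prod_beta continuous_on_fst)
  next
    case False
    then have "(\<lambda>(x, t). ?D i j x t) = (\<lambda>_. if i = 1 \<and> j = 0 then 1 else 0)" by auto
    then show ?thesis by (simp only: continuous_on_const)
  qed
  then show "partials_of I (\<lambda>x t. x) ?D"
    unfolding partials_of_def by auto
qed

lemma smooth_space:
  assumes "\<And>n x. (deriv ^^ n) f differentiable (at x)"
  shows "smooth_on_strip I (\<lambda>x t. f x)"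
proof -
  have d: "((deriv ^^ n) f has_real_derivative (deriv ^^ Suc n) f x) (at x)" for n x
    using assms[of n x] by (simp add: DERIV_deriv_iff_real_differentiable)
  have c: "continuous_on UNIV ((deriv ^^ n) f)" for n
    using d by (auto intro: DERIV_continuous_on)
  then have "continuous_on (UNIV \<times> I) (\<lambda>p. (deriv ^^ n) f (fst p))" for n
    by (rule continuous_on_compose2) (auto intro!: continuous_intros)
  then have "continuous_on (UNIV \<times> I) (\<lambda>(x, t). if j = 0 then (deriv ^^ i) f x else 0)" for i j :: nat
    by (cases "j = 0") (simp_all add: case_prod_beta)
  then show ?thesis
    unfolding smooth_on_strip_def using d
    by (intro exI[of _ "\<lambda>i j x t. if j = 0 then (deriv ^^ i) f x else 0"])
       (auto simp: partials_of_def)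
qed

lemma smooth_diff:
  assumes "open I" "convex I" "smooth_on_strip I v" "smooth_on_strip I w"
  shows "smooth_on_strip I (\<lambda>x t. v x t - w x t)"
  using smooth_add[OF assms(1,2,3) smooth_mult[OF assms(1,2) smooth_const[of I "-1"] assms(4)]]
  by simp

lemma smooth_inverse:
  assumes I: "open I" "convex I" and w: "smooth_on_strip I w"
    and nz: "\<And>x t. t \<in> I \<Longrightarrow> w x t \<noteq> 0"
  shows "smooth_on_strip I (\<lambda>x t. inverse (w x t))"
proof (rule smooth_by_generators[of I "{\<lambda>x t. inverse (w x t)}", OF I])
  let ?v = "\<lambda>x t. inverse (w x t)"
  let ?A = "gen_alg ({?v} \<union> Collect (smooth_on_strip I))"
  obtain wx wt where wp: "has_partials I w wx wt" and sm: "smooth_on_strip I wx" "smooth_on_strip I wt"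
    using smooth_has_partials[OF I(1) w] .
  have v: "?v \<in> ?A" by (auto intro: gen_alg.base)
  have mem: "(\<lambda>x t. (-1) * y x t * (?v x t * ?v x t)) \<in> ?A" if "smooth_on_strip I y" for y
  proof (intro gen_alg.mult[OF _ gen_alg.mult[OF v v]] gen_alg.base UnI2 CollectI)
    show "smooth_on_strip I (\<lambda>x t. (-1) * y x t)"
      by (intro smooth_mult[OF I] smooth_const that)
  qed
  have "has_partials I ?v (\<lambda>x t. (-1) * wx x t * (?v x t * ?v x t))
      (\<lambda>x t. (-1) * wt x t * (?v x t * ?v x t))"
    unfolding has_partials_def
    using has_partialsD[OF wp] nz
    by (auto simp: case_prod_beta power2_eq_square mult_ac intro!: continuous_intros derivative_eq_intros)
  then show "\<exists>bx\<in>?A. \<exists>bt\<in>?A. has_partials I b bx bt" if "b \<in> {?v}" for b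
    using that mem sm by blast
  show "?v \<in> ?A" by (rule v)
qed

section \<open>Antiderivatives in space\<close>

text \<open>The substitution \<open>b = a s\<close> turns the integral of \<open>h\<close> over \<open>[0, a]\<close> into \<open>a\<close> times an integral over
  the fixed interval \<open>[0, 1]\<close>, for either sign of \<open>a\<close>. Each space derivative then contributes a
  factor \<open>s\<close>, hence the powers.\<close>
definition ray_moment :: "nat \<Rightarrow> (real \<Rightarrow> real \<Rightarrow> real) \<Rightarrow> real \<Rightarrow> real \<Rightarrow> real" where
  "ray_moment n h a t = integral {0..1} (\<lambda>s. s ^ n * h (a * s) t)"

lemma ray_moment_partials:
  fixes I :: "real set"
  assumes I: "open I" "convex I" and h: "has_partials I h ha ht"
    and ca: "continuous_on (UNIV \<times> I) (\<lambda>(x, t). ha x t)"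
    and ct: "continuous_on (UNIV \<times> I) (\<lambda>(x, t). ht x t)"
  shows "has_partials I (ray_moment n h) (ray_moment (Suc n) ha) (ray_moment n ht)"
  unfolding has_partials_def
proof (intro conjI allI ballI)
  note c = has_partialsD(1)[OF h]
  have "continuous_on ((UNIV \<times> I) \<times> cbox 0 1) (\<lambda>q. snd q ^ n * h (fst (fst q) * snd q) (snd (fst q)))"
    by (intro continuous_intros continuous_on_strip_compose[OF c]) auto
  then have "continuous_on (UNIV \<times> I)
      (\<lambda>p. integral (cbox 0 1) ((\<lambda>p s. s ^ n * h (fst p * s) (snd p)) p))"
    by (intro integral_continuous_on_param) (simp add: case_prod_beta)
  then show "continuous_on (UNIV \<times> I) (\<lambda>(a, t). ray_moment n h a t)"
    by (simp add: ray_moment_def case_prod_beta)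
next
  fix a t assume t: "t \<in> I"
  note c = has_partialsD(1)[OF h]
  have int: "(\<lambda>s. s ^ n * h (b * s) r) integrable_on cbox 0 1" if "r \<in> I" for b r
    by (intro integrable_continuous continuous_intros continuous_on_strip_compose[OF c] that)
  have "((\<lambda>b. integral (cbox 0 1) (\<lambda>s. s ^ n * h (b * s) t)) has_field_derivative
      integral (cbox 0 1) (\<lambda>s. s ^ Suc n * ha (a * s) t)) (at a within UNIV)"
  proof (rule leibniz_rule_field_derivative)
    fix b s :: real
    have "((\<lambda>b. h (b * s) t) has_field_derivative ha (b * s) t * s) (at b)"
      by (rule DERIV_chain2[OF has_partialsD(2)[OF h t]]) (auto intro!: derivative_eq_intros)
    from DERIV_cmult[OF this, of "s ^ n"]
    show "((\<lambda>b. s ^ n * h (b * s) t) has_field_derivative s ^ Suc n * ha (b * s) t) (at b within UNIV)"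
      by (simp add: mult_ac)
  next
    have "continuous_on (UNIV \<times> cbox 0 1) (\<lambda>q::real \<times> real. snd q ^ Suc n * ha (fst q * snd q) t)"
      by (intro continuous_intros continuous_on_strip_compose[OF ca] t)
    then show "continuous_on (UNIV \<times> cbox 0 1) (\<lambda>(b, s). s ^ Suc n * ha (b * s) t)"
      by (simp add: case_prod_beta)
  qed (use int t in auto)
  then show "((\<lambda>b. ray_moment n h b t) has_real_derivative ray_moment (Suc n) ha a t) (at a)"
    by (simp add: ray_moment_def)
  have "((\<lambda>r. integral (cbox 0 1) (\<lambda>s. s ^ n * h (a * s) r)) has_field_derivative
      integral (cbox 0 1) (\<lambda>s. s ^ n * ht (a * s) t)) (at t within I)"
  proof (rule leibniz_rule_field_derivative[OF _ int _ t I(2)])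
    fix r s :: real assume "r \<in> I"
    from has_partialsD(3)[OF h this, of "a * s"]
    have "((\<lambda>r. h (a * s) r) has_field_derivative ht (a * s) r) (at r within I)"
      by (rule has_field_derivative_at_within)
    from DERIV_cmult[OF this, of "s ^ n"]
    show "((\<lambda>r. s ^ n * h (a * s) r) has_field_derivative s ^ n * ht (a * s) r) (at r within I)" .
  next
    have "continuous_on (I \<times> cbox 0 1) (\<lambda>q. snd q ^ n * ht (a * snd q) (fst q))"
      by (intro continuous_intros continuous_on_strip_compose[OF ct]) auto
    then show "continuous_on (I \<times> cbox 0 1) (\<lambda>(r, s). s ^ n * ht (a * s) r)"
      by (simp add: case_prod_beta)
  qed
  then show "((\<lambda>r. ray_moment n h a r) has_real_derivative ray_moment n ht a t) (at t)"
    unfolding at_within_open[OF t I(1)] by (simp add: ray_moment_def)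
qed

definition primitive :: "(real \<Rightarrow> real \<Rightarrow> real) \<Rightarrow> real \<Rightarrow> real \<Rightarrow> real" where
  "primitive h a t = a * integral {0..1} (\<lambda>s. h (a * s) t)"

text \<open>The integrals \<open>ray_moment n h\<close> with \<open>h\<close> smooth are closed under partial derivatives.\<close>
lemma smooth_primitive:
  fixes I :: "real set"
  assumes I: "open I" "convex I" and h: "smooth_on_strip I h"
  shows "smooth_on_strip I (primitive h)"
proof -
  let ?F = "{ray_moment n h | n h. smooth_on_strip I h}"
  have F: "partials_closed I ?F"
    unfolding partials_closed_def
  proof safe
    fix n h assume "smooth_on_strip I h"
    then obtain ha ht where "has_partials I h ha ht" "smooth_on_strip I ha" "smooth_on_strip I ht"
      by (rule smooth_has_partials[OF I(1)])
    then show "\<exists>wx\<in>?F. \<exists>wt\<in>?F. has_partials I (ray_moment n h) wx wt"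
      by (intro bexI[of _ "ray_moment (Suc n) ha"] bexI[of _ "ray_moment n ht"]
          ray_moment_partials[OF I] smooth_continuous) blast+
  qed
  have "ray_moment 0 h \<in> ?F"
    using h by blast
  from partials_closed_imp_partials_of[OF I F this]
  obtain D where "partials_of I (ray_moment 0 h) D" by blast
  then have "smooth_on_strip I (ray_moment 0 h)"
    by (auto simp: smooth_on_strip_def)
  with smooth_position have "smooth_on_strip I (\<lambda>x t. x * ray_moment 0 h x t)"
    by (intro smooth_mult[OF I])
  then show ?thesis
    by (simp add: primitive_def[abs_def] ray_moment_def)
qed

lemma primitive_partials:
  fixes I :: "real set"
  assumes I: "open I" "convex I" and h: "has_partials I h ha ht"
    and ca: "continuous_on (UNIV \<times> I) (\<lambda>(x, t). ha x t)"
    and ct: "continuous_on (UNIV \<times> I) (\<lambda>(x, t). ht x t)"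
  shows "has_partials I (primitive h) h (primitive ht)"
  unfolding has_partials_def
proof (intro conjI allI ballI)
  have eq: "primitive h = (\<lambda>a t. a * ray_moment 0 h a t)" for h
    by (simp add: primitive_def[abs_def] ray_moment_def)
  note hp = ray_moment_partials[OF I h ca ct, of 0]
  have "continuous_on (UNIV \<times> I) (\<lambda>p. fst p * ray_moment 0 h (fst p) (snd p))"
    using has_partialsD(1)[OF hp] by (intro continuous_intros) (simp add: case_prod_beta)
  then show "continuous_on (UNIV \<times> I) (\<lambda>(a, t). primitive h a t)"
    by (simp add: eq case_prod_beta)
  fix a t assume t: "t \<in> I"
  show "((\<lambda>r. primitive h a r) has_real_derivative primitive ht a t) (at t)"
    unfolding eq by (rule DERIV_cmult[OF has_partialsD(3)[OF hp t]])
  \<comment> \<open>The product rule for \<open>a \<cdot> ray_moment 0 h\<close> leaves \<open>\<integral> h(a s) + a s h\<^sub>a(a s) ds\<close>, whose integrand is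
    the derivative of \<open>s h(a s)\<close>.\<close>
  have "((\<lambda>s. h (a * s) t + a * (s * ha (a * s) t)) has_integral 1 * h (a * 1) t - 0 * h (a * 0) t) {0..1}"
  proof (rule fundamental_theorem_of_calculus)
    fix s :: real
    have "((\<lambda>s. h (a * s) t) has_field_derivative ha (a * s) t * a) (at s)"
      by (rule DERIV_chain2[OF has_partialsD(2)[OF h t]]) (auto intro!: derivative_eq_intros)
    from DERIV_mult[OF DERIV_ident this]
    have "((\<lambda>s. s * h (a * s) t) has_field_derivative h (a * s) t + a * (s * ha (a * s) t)) (at s)"
      by (simp add: algebra_simps)
    then show "((\<lambda>s. s * h (a * s) t) has_vector_derivative h (a * s) t + a * (s * ha (a * s) t))
        (at s within {0..1})"
      by (simp add: has_real_derivative_iff_has_vector_derivative[symmetric] has_field_derivative_at_within)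
  qed simp
  then have "integral {0..1} (\<lambda>s. h (a * s) t + a * (s * ha (a * s) t)) = h a t"
    by (simp add: integral_unique)
  moreover have "(\<lambda>s. h (a * s) t) integrable_on {0..1}" "(\<lambda>s. a * (s * ha (a * s) t)) integrable_on {0..1}"
    by (intro integrable_continuous_real continuous_intros
        continuous_on_strip_compose[OF has_partialsD(1)[OF h]] continuous_on_strip_compose[OF ca] t)+
  ultimately have "ray_moment 0 h a t + a * ray_moment 1 ha a t = h a t"
    by (simp add: ray_moment_def integral_add)
  with DERIV_mult[OF DERIV_ident has_partialsD(2)[OF hp t, of a]]
  show "((\<lambda>b. primitive h b t) has_real_derivative h a t) (at a)"
    by (simp add: eq mult_ac)
qed

text \<open>Space derivatives at one point and a continuous time derivative already give the total derivative,
  one-sided at a boundary point of the time set. It is used for the chain rule along the flow.\<close>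
lemma has_derivative_strip:
  fixes w wt :: "real \<Rightarrow> real \<Rightarrow> real"
  assumes wx: "((\<lambda>y. w y t) has_real_derivative d) (at x)"
    and wt: "\<And>y s. s \<in> I \<Longrightarrow> ((\<lambda>s. w y s) has_real_derivative wt y s) (at s within I)"
    and cont: "continuous_on (UNIV \<times> I) (\<lambda>(y, s). wt y s)"
    and t: "t \<in> I" "convex I"
  shows "((\<lambda>(y, s). w y s) has_derivative (\<lambda>(h, k). d * h + wt x t * k)) (at (x, t) within UNIV \<times> I)"
proof -
  have "((\<lambda>(y, s). w y s) has_derivative
      (\<lambda>(h, k). d * h + blinfun_apply (blinfun_mult_right (wt x t)) k)) (at (x, t) within UNIV \<times> I)"
  proof (rule has_derivative_partialsI[where fy = "\<lambda>y s. blinfun_mult_right (wt y s)"])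
    show "((\<lambda>y. w y t) has_derivative (*) d) (at x within UNIV)"
      using wx by (simp add: has_field_derivative_def)
    show "((\<lambda>s. w y s) has_derivative blinfun_apply (blinfun_mult_right (wt y s))) (at s within I)"
      if "s \<in> I" for y s
      using wt[OF that, of y] by (simp add: has_field_derivative_def blinfun_mult_right.rep_eq)
    have "continuous_on (UNIV \<times> I) (\<lambda>p. blinfun_mult_right (case p of (y, s) \<Rightarrow> wt y s))"
      by (rule bounded_linear.continuous_on[OF bounded_linear_blinfun_mult_right cont])
    then show "continuous (at (x, t) within UNIV \<times> I) (\<lambda>(y, s). blinfun_mult_right (wt y s))"
      using t(1) by (simp add: continuous_on_eq_continuous_within case_prod_unfold)
  qed (use t in auto)
  then show ?thesis
    by (simp add: blinfun_mult_right.rep_eq)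
qed

lemma affine_of_constant_derivative:
  fixes g :: "real \<Rightarrow> real"
  assumes "\<And>x. (g has_real_derivative g' x) (at x)" "\<And>x. a < x \<Longrightarrow> x < b \<Longrightarrow> g' x = k" "a \<le> b"
  shows "g b = g a + k * (b - a)"
proof (cases "a = b")
  case False
  then obtain z where "a < z" "z < b" "g b - g a = (b - a) * g' z"
    using MVT2[of a b g g'] assms by auto
  then show ?thesis using assms(2)[of z] by (simp add: algebra_simps)
qed simp

section \<open>From Lagrangian profiles to classical solutions\<close>

text \<open>The system in the label variable. The time set is open, so that the inverse function theorem and
  two-sided derivatives are available; the initial time is interior to it, and solutions forward in time
  are obtained by restriction to \<open>{0..}\<close>. The profiles are trivial beyond label \<open>R\<close>.\<close>
locale lagrangian_solution =
  fixes I :: "real set" and \<sigma> R :: real and J Q U :: "real \<Rightarrow> real \<Rightarrow> real"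
  assumes I: "open I" "convex I" "0 \<in> I"
    and smooth: "smooth_on_strip I J" "smooth_on_strip I Q" "smooth_on_strip I U"
    and J_pos: "t \<in> I \<Longrightarrow> 0 < J a t"
    and J_t: "t \<in> I \<Longrightarrow> ((\<lambda>s. J a s) has_real_derivative 2 * Q a t * J a t) (at t)"
    and U_t: "t \<in> I \<Longrightarrow> ((\<lambda>s. U a s) has_real_derivative 2 * Q a t * U a t) (at t)"
    and Q_t: "t \<in> I \<Longrightarrow> ((\<lambda>s. Q a s) has_real_derivative (Q a t)\<^sup>2 - \<sigma> * (U a t)\<^sup>2) (at t)"
    and J_init: "J a 0 = 1"
    and outside: "t \<in> I \<Longrightarrow> R < \<bar>a\<bar> \<Longrightarrow> J a t = 1 \<and> Q a t = 0 \<and> U a t = 0"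
begin

text \<open>The flow: it starts as the identity, has Jacobian \<open>J\<close> and keeps the origin fixed.\<close>
definition X where "X = primitive J"
text \<open>The velocity \<open>X\<^sub>t = V(X, t)\<close> as a function of the label, obtained by integrating \<open>J\<^sub>t\<close>.\<close>
definition W where "W = primitive (\<lambda>a t. 2 * Q a t * J a t)"

lemma smooth_J_t: "smooth_on_strip I (\<lambda>a t. 2 * Q a t * J a t)"
  by (intro smooth_mult[OF I(1,2)] smooth_const smooth)

lemma smooth_W: "smooth_on_strip I W"
  unfolding W_def by (intro smooth_primitive I smooth_J_t)

lemma X_partials: "has_partials I X J W"
proof -
  obtain Ja Jt where J: "has_partials I J Ja Jt" "smooth_on_strip I Ja"
    using smooth_has_partials[OF I(1) smooth(1)] .
  then have "has_partials I J Ja (\<lambda>a t. 2 * Q a t * J a t)"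
    using J_t unfolding has_partials_def by blast
  then show ?thesis
    unfolding X_def W_def using J smooth_J_t
    by (intro primitive_partials I smooth_continuous)
qed

lemma W_space_derivative:
  assumes "t \<in> I" shows "((\<lambda>a. W a t) has_real_derivative 2 * Q a t * J a t) (at a)"
proof -
  obtain ha ht where h: "has_partials I (\<lambda>a t. 2 * Q a t * J a t) ha ht"
    "smooth_on_strip I ha" "smooth_on_strip I ht"
    using smooth_has_partials[OF I(1) smooth_J_t] .
  then have "has_partials I W (\<lambda>a t. 2 * Q a t * J a t) (primitive ht)"
    unfolding W_def by (intro primitive_partials I smooth_continuous)
  from has_partialsD(2)[OF this assms] show ?thesis .
qed

lemma X_0: "X 0 t = 0" and W_0: "W 0 t = 0"
  by (simp_all add: X_def W_def primitive_def)

lemma X_init: "X a 0 = a"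
  by (simp add: X_def primitive_def J_init)

lemma X_strict_mono:
  assumes "t \<in> I" shows "strict_mono (\<lambda>a. X a t)"
proof (rule strict_monoI)
  fix a b :: real assume "a < b"
  then show "X a t < X b t"
    by (rule DERIV_pos_imp_increasing)
       (use has_partialsD(2)[OF X_partials assms] J_pos[OF assms] in blast)
qed

text \<open>Beyond the labels \<open>\<plusminus>R\<close> the flow is a translation.\<close>
lemma X_surj:
  assumes t: "t \<in> I" shows "\<exists>a. X a t = x"
proof -
  note d = has_partialsD(2)[OF X_partials t]
  define b where "b = R + max 0 (x - X R t)"
  define a where "a = - R - max 0 (X (- R) t - x)"
  have "X b t = X R t + 1 * (b - R)"
    by (rule affine_of_constant_derivative[OF d]) (use outside[OF t] in \<open>auto simp: b_def\<close>)
  then have b: "x \<le> X b t" by (simp add: b_def)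
  have "X (- R) t = X a t + 1 * (- R - a)"
    by (rule affine_of_constant_derivative[OF d]) (use outside[OF t] in \<open>auto simp: a_def\<close>)
  then have a: "X a t \<le> x" by (simp add: a_def)
  have "a \<le> b"
    using a b X_strict_mono[OF t] by (meson order.trans strict_mono_less_eq)
  moreover have "continuous_on {a..b} (\<lambda>a. X a t)"
    using d by (meson DERIV_continuous_on has_field_derivative_at_within)
  ultimately show ?thesis
    using IVT'[of "\<lambda>a. X a t", OF a b] by blast
qed

definition A where "A x t = inv (\<lambda>a. X a t) x"

lemma A_X: "t \<in> I \<Longrightarrow> A (X a t) t = a"
  unfolding A_def by (rule inv_f_f) (rule strict_mono_imp_inj_on[OF X_strict_mono])

lemma X_A: "t \<in> I \<Longrightarrow> X (A x t) t = x"
  using X_surj A_X by metis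

text \<open>The inverse function theorem is applied to \<open>(a, t) \<mapsto> (X(a, t), t)\<close> rather than to \<open>X\<close> at fixed
  times, since the time derivative of the inverse is needed as well.\<close>
lemma A_has_derivative:
  assumes t: "t \<in> I"
  shows "((\<lambda>(x, t). (A x t, t)) has_derivative
    (\<lambda>(h, k). ((h - W (A x t) t * k) / J (A x t) t, k))) (at (x, t))"
proof -
  let ?a = "A x t"
  let ?\<Phi> = "\<lambda>p. (X (fst p) (snd p), snd p)"
  let ?\<Phi>' = "\<lambda>p. (J ?a t * fst p + W ?a t * snd p, snd p)"
  let ?\<Psi>' = "\<lambda>p. ((fst p - W ?a t * snd p) / J ?a t, snd p)"
  have op: "open (UNIV \<times> I :: (real \<times> real) set)" and mem: "(?a, t) \<in> UNIV \<times> I"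
    using I t by (auto intro: open_Times)
  have "((\<lambda>(a, t). X a t) has_derivative (\<lambda>(h, k). J ?a t * h + W ?a t * k)) (at (?a, t) within UNIV \<times> I)"
    using has_partialsD(3)[OF X_partials] smooth_continuous[OF smooth_W] t I
    by (intro has_derivative_strip has_partialsD(2)[OF X_partials t])
       (auto intro: has_field_derivative_at_within)
  then have "((\<lambda>p. X (fst p) (snd p)) has_derivative (\<lambda>p. J ?a t * fst p + W ?a t * snd p)) (at (?a, t))"
    unfolding at_within_open[OF mem op] by (simp only: case_prod_unfold)
  then have der: "(?\<Phi> has_derivative ?\<Phi>') (at (?a, t))"
    by (intro has_derivative_Pair) (auto intro!: derivative_eq_intros)
  have "((\<lambda>p. (A (fst p) (snd p), snd p)) has_derivative ?\<Psi>') (at (?\<Phi> (?a, t)))"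
  proof (rule has_derivative_inverse_strong[OF op mem _ _ der])
    show "continuous_on (UNIV \<times> I) ?\<Phi>"
      using has_partialsD(1)[OF X_partials] by (intro continuous_intros) (simp add: case_prod_beta)
    show "?\<Phi>' \<circ> ?\<Psi>' = id"
      using J_pos[OF t, of ?a] by (auto simp: fun_eq_iff)
  qed (auto simp: A_X)
  then show ?thesis
    by (simp add: X_A[OF t] case_prod_unfold)
qed

definition eulerian where "eulerian G x t = G (A x t) t"

text \<open>The chain rule with \<open>A\<^sub>x = 1 / J\<close> and \<open>A\<^sub>t = - W / J\<close>. The second identity is the transport equation
  for labels, which makes \<open>\<partial>\<^sub>t + V \<partial>\<^sub>x\<close> act as \<open>\<partial>\<^sub>t\<close> at fixed label.\<close>
lemma eulerian_partials:
  assumes G: "has_partials I G Ga Gt" and ct: "continuous_on (UNIV \<times> I) (\<lambda>(a, t). Gt a t)"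
  shows "has_partials I (eulerian G) (eulerian (\<lambda>a t. Ga a t * inverse (J a t)))
    (eulerian (\<lambda>a t. Gt a t - W a t * (Ga a t * inverse (J a t))))"
  unfolding has_partials_def
proof (intro conjI allI ballI)
  have "continuous_on (UNIV \<times> I) (\<lambda>(x, t). (A x t, t))"
    using A_has_derivative
    by (intro continuous_at_imp_continuous_on) (auto intro: has_derivative_continuous)
  then have "continuous_on (UNIV \<times> I) (\<lambda>p. A (fst p) (snd p))"
    using continuous_on_fst by (fastforce simp: case_prod_beta)
  then have "continuous_on (UNIV \<times> I) (\<lambda>p. G (A (fst p) (snd p)) (snd p))"
    by (intro continuous_on_strip_compose[OF has_partialsD(1)[OF G]] continuous_intros) auto
  then show "continuous_on (UNIV \<times> I) (\<lambda>(x, t). eulerian G x t)"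
    by (simp add: eulerian_def case_prod_beta)
next
  fix x t assume t: "t \<in> I"
  let ?a = "A x t"
  have op: "open (UNIV \<times> I :: (real \<times> real) set)" and mem: "(?a, t) \<in> UNIV \<times> I"
    using I t by (auto intro: open_Times)
  have "((\<lambda>(a, t). G a t) has_derivative (\<lambda>(h, k). Ga ?a t * h + Gt ?a t * k)) (at (?a, t) within UNIV \<times> I)"
    using has_partialsD(3)[OF G] ct t I
    by (intro has_derivative_strip has_partialsD(2)[OF G t]) (auto intro: has_field_derivative_at_within)
  then have "((\<lambda>(a, t). G a t) has_derivative (\<lambda>(h, k). Ga ?a t * h + Gt ?a t * k))
      (at ((\<lambda>(x, t). (A x t, t)) (x, t)))"
    unfolding at_within_open[OF mem op] by simp
  from has_derivative_compose[OF A_has_derivative[OF t] this]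
  have der: "((\<lambda>p. G (A (fst p) (snd p)) (snd p)) has_derivative
      (\<lambda>p. Ga ?a t * ((fst p - W ?a t * snd p) / J ?a t) + Gt ?a t * snd p)) (at (x, t))"
    by (simp add: case_prod_unfold)
  have "((\<lambda>y. (y, t)) has_derivative (\<lambda>h. (h, 0))) (at x)"
    by (auto intro!: derivative_eq_intros)
  from has_derivative_compose[OF this der]
  have "((\<lambda>y. G (A y t) t) has_derivative (\<lambda>h. Ga ?a t * (h / J ?a t))) (at x)"
    by simp
  then show "((\<lambda>y. eulerian G y t) has_real_derivative eulerian (\<lambda>a t. Ga a t * inverse (J a t)) x t) (at x)"
    unfolding has_field_derivative_def eulerian_def
    by (rule has_derivative_eq_rhs) (simp add: fun_eq_iff field_simps)
  have "((\<lambda>s. (x, s)) has_derivative (\<lambda>k. (0, k))) (at t)"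
    by (auto intro!: derivative_eq_intros)
  from has_derivative_compose[OF this der]
  have "((\<lambda>s. G (A x s) s) has_derivative (\<lambda>k. Ga ?a t * (- (W ?a t * k) / J ?a t) + Gt ?a t * k)) (at t)"
    by simp
  then show "((\<lambda>s. eulerian G x s) has_real_derivative
      eulerian (\<lambda>a t. Gt a t - W a t * (Ga a t * inverse (J a t))) x t) (at t)"
    unfolding has_field_derivative_def eulerian_def
    by (rule has_derivative_eq_rhs) (simp add: fun_eq_iff field_simps)
qed

lemma smooth_inverse_J: "smooth_on_strip I (\<lambda>a t. inverse (J a t))"
  using J_pos by (intro smooth_inverse I smooth) (metis less_irrefl)

definition supported where
  "supported G \<longleftrightarrow> (\<forall>t\<in>I. \<forall>a. R < \<bar>a\<bar> \<longrightarrow> G a t = (0::real))"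

lemma supported_partials:
  assumes G: "has_partials I G Ga Gt" and supp: "supported G"
  shows "supported Ga" "supported Gt"
proof -
  have "Ga a t = 0 \<and> Gt a t = 0" if t: "t \<in> I" and a: "R < \<bar>a\<bar>" for a t
  proof
    have "open {b::real. R < \<bar>b\<bar>}"
      by (intro open_Collect_less continuous_intros)
    then have "((\<lambda>b. G b t) has_real_derivative 0) (at a)"
      by (rule has_field_derivative_transform_within_open[of "\<lambda>_. 0", rotated])
         (use a t supp in \<open>auto simp: supported_def\<close>)
    with has_partialsD(2)[OF G t] show "Ga a t = 0"
      by (rule DERIV_unique)
    have "((\<lambda>s. G a s) has_real_derivative 0) (at t)"
      by (rule has_field_derivative_transform_within_open[of "\<lambda>_. 0", OF _ I(1) t])
         (use a supp in \<open>auto simp: supported_def\<close>)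
    with has_partialsD(3)[OF G t] show "Gt a t = 0"
      by (rule DERIV_unique)
  qed
  then show "supported Ga" "supported Gt" by (auto simp: supported_def)
qed

text \<open>By the formulas for the partial derivatives, together with the smoothness of \<open>1 / J\<close> and \<open>W\<close>; the
  support in the label variable does not grow under differentiation.\<close>
lemma eulerian_closed:
  "partials_closed I {eulerian G | G. smooth_on_strip I G}" (is ?thesis1)
  "partials_closed I {eulerian G | G. smooth_on_strip I G \<and> supported G}" (is ?thesis2)
proof -
  have *: "\<exists>Gx Gt. has_partials I (eulerian G) (eulerian Gx) (eulerian Gt) \<and>
      smooth_on_strip I Gx \<and> smooth_on_strip I Gt \<and> (supported G \<longrightarrow> supported Gx \<and> supported Gt)"
    if "smooth_on_strip I G" for G
  proof -
    obtain Ga Gt where G: "has_partials I G Ga Gt" "smooth_on_strip I Ga" "smooth_on_strip I Gt"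
      using smooth_has_partials[OF I(1) \<open>smooth_on_strip I G\<close>] .
    let ?x = "\<lambda>a t. Ga a t * inverse (J a t)"
    let ?t = "\<lambda>a t. Gt a t - W a t * ?x a t"
    have "smooth_on_strip I ?x"
      by (rule smooth_mult[OF I(1,2) G(2) smooth_inverse_J])
    moreover have "smooth_on_strip I ?t"
      by (rule smooth_diff[OF I(1,2) G(3) smooth_mult[OF I(1,2) smooth_W calculation]])
    moreover have "supported ?x \<and> supported ?t" if "supported G"
      using supported_partials[OF G(1) that] by (simp add: supported_def)
    ultimately show ?thesis
      using eulerian_partials[OF G(1) smooth_continuous[OF G(3)]] by blast
  qed
  show ?thesis1 ?thesis2
    unfolding partials_closed_def using * by blast+
qed

lemma eulerian_decays:
  assumes t: "t \<in> I" and G: "supported G"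
  shows "((\<lambda>x. eulerian G x t) \<longlongrightarrow> 0) at_infinity"
proof (rule tendsto_eventually)
  have "eulerian G x t = 0" if "\<bar>X R t\<bar> + \<bar>X (- R) t\<bar> + 1 \<le> norm x" for x
  proof -
    have "X R t < X (A x t) t \<or> X (A x t) t < X (- R) t"
      using that by (auto simp: X_A[OF t])
    then have "R < \<bar>A x t\<bar>"
      using strict_mono_less[OF X_strict_mono[OF t]] by fastforce
    then show ?thesis
      using G t by (simp add: supported_def eulerian_def)
  qed
  then show "\<forall>\<^sub>F x in at_infinity. eulerian G x t = 0"
    unfolding eventually_at_infinity by blast
qed

lemma eulerian_smooth:
  assumes "smooth_on_strip I G" "K \<subseteq> I"
  shows "smooth_on_strip K (eulerian G)"
proof -
  have "eulerian G \<in> {eulerian G | G. smooth_on_strip I G}"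
    using assms by blast
  from partials_closed_imp_partials_of[OF I(1,2) eulerian_closed(1) this]
  obtain D where "partials_of I (eulerian G) D" by blast
  then show ?thesis
    using partials_of_subset[OF _ assms(2)] by (auto simp: smooth_on_strip_def)
qed

lemma eulerian_smooth_decaying:
  assumes "smooth_on_strip I G" "supported G" "K \<subseteq> I"
  shows "smooth_decaying_on_strip K (eulerian G)"
proof -
  have "eulerian G \<in> {eulerian G | G. smooth_on_strip I G \<and> supported G}"
    using assms by blast
  from partials_closed_imp_partials_of[OF I(1,2) eulerian_closed(2) this]
  obtain D where D: "partials_of I (eulerian G) D"
    "\<And>i j. D i j \<in> {eulerian G | G. smooth_on_strip I G \<and> supported G}"
    by blast
  have "((\<lambda>x. D i j x t) \<longlongrightarrow> 0) at_infinity" if "t \<in> K" for i j t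
    using D(2)[of i j] eulerian_decays[of t] that assms(3) by auto
  then show ?thesis
    using partials_of_subset[OF D(1) assms(3)] by (auto simp: smooth_decaying_on_strip_def)
qed

text \<open>The velocity has derivative \<open>2 Q J = 0\<close> at large labels; its two constant values there are the
  limits of \<open>V\<close> at infinity.\<close>
lemma W_constant_outside:
  assumes t: "t \<in> I"
  shows "R \<le> a \<Longrightarrow> W a t = W R t" "a \<le> - R \<Longrightarrow> W a t = W (- R) t"
proof -
  show "W a t = W R t" if "R \<le> a"
    using affine_of_constant_derivative[OF W_space_derivative[OF t], of R a 0] that outside[OF t]
    by fastforce
  show "W a t = W (- R) t" if "a \<le> - R"
    using affine_of_constant_derivative[OF W_space_derivative[OF t], of a "- R" 0] that outside[OF t]
    by fastforce
qed

lemma nontrivial_limit_forward: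
  assumes "t \<in> I" "0 \<le> t" shows "at t within I \<inter> {0..} \<noteq> bot"
proof -
  have "at t within I \<inter> {0..} = at t within {0..}"
    using I(1) assms by (intro at_within_nhd[of _ I]) auto
  moreover have "at_right t \<le> at t within {0..}"
    using assms by (intro at_le) auto
  ultimately show ?thesis
    using trivial_limit_at_right_real[of t] by (metis bot.extremum_uniqueI)
qed

text \<open>The equations hold because the transport derivative is the time derivative at fixed label, and
  \<open>V\<^sub>x = W\<^sub>a / J = 2 Q\<close>.\<close>
theorem classical_solution_eulerian:
  "classical_solution \<sigma> (\<lambda>x. U x 0) (\<lambda>x. Q x 0) (I \<inter> {0..}) (eulerian U) (eulerian Q) (eulerian W)"
  unfolding classical_solution_def
proof (intro conjI ballI allI)
  have "supported U" "supported Q"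
    using outside by (auto simp: supported_def)
  then show "smooth_decaying_on_strip (I \<inter> {0..}) (eulerian U)" "smooth_decaying_on_strip (I \<inter> {0..}) (eulerian Q)"
    by (auto intro!: eulerian_smooth_decaying smooth)
  show "smooth_on_strip (I \<inter> {0..}) (eulerian W)"
    by (auto intro!: eulerian_smooth smooth_W)
  have A0: "A x 0 = x" for x
    using A_X[OF I(3), of x] by (simp add: X_init)
  show "eulerian U x 0 = U x 0" "eulerian Q x 0 = Q x 0" for x
    by (simp_all add: eulerian_def A0)
  fix t assume "t \<in> I \<inter> {0..}"
  then have t: "t \<in> I" "0 \<le> t" by auto
  show "eulerian W 0 t = 0"
    using A_X[OF t(1), of 0] by (simp add: eulerian_def X_0 W_0)
  have "eulerian W x t = W R t" if "X R t \<le> x" for x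
  proof -
    have "X R t \<le> X (A x t) t" using that by (simp add: X_A[OF t(1)])
    then have "R \<le> A x t" by (simp add: strict_mono_less_eq[OF X_strict_mono[OF t(1)]])
    then show ?thesis unfolding eulerian_def by (rule W_constant_outside[OF t(1)])
  qed
  then have "\<forall>\<^sub>F x in at_top. eulerian W x t = W R t"
    unfolding eventually_at_top_linorder by blast
  then show "\<exists>l. ((\<lambda>x. eulerian W x t) \<longlongrightarrow> l) at_top"
    by (intro exI tendsto_eventually)
  have "eulerian W x t = W (- R) t" if "x \<le> X (- R) t" for x
  proof -
    have "X (A x t) t \<le> X (- R) t" using that by (simp add: X_A[OF t(1)])
    then have "A x t \<le> - R" by (simp add: strict_mono_less_eq[OF X_strict_mono[OF t(1)]])
    then show ?thesis unfolding eulerian_def by (rule W_constant_outside[OF t(1)])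
  qed
  then have "\<forall>\<^sub>F x in at_bot. eulerian W x t = W (- R) t"
    unfolding eventually_at_bot_linorder by blast
  then show "\<exists>l. ((\<lambda>x. eulerian W x t) \<longlongrightarrow> l) at_bot"
    by (intro exI tendsto_eventually)
  fix x
  let ?a = "A x t"
  have transport: "dt (I \<inter> {0..}) (eulerian G) x t + eulerian W x t * dx (eulerian G) x t = g"
    if G: "smooth_on_strip I G" and g: "((\<lambda>s. G ?a s) has_real_derivative g) (at t)" for G g
  proof -
    obtain Ga Gt where hp: "has_partials I G Ga Gt" and sm: "smooth_on_strip I Gt"
      using smooth_has_partials[OF I(1) G] .
    note e = eulerian_partials[OF hp smooth_continuous[OF sm]]
    have "Gt ?a t = g"
      using has_partialsD(3)[OF hp t(1)] g by (rule DERIV_unique)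
    moreover have "dx (eulerian G) x t = Ga ?a t * inverse (J ?a t)"
      unfolding dx_def using has_partialsD(2)[OF e t(1)]
      by (intro DERIV_imp_deriv) (simp add: eulerian_def)
    moreover have "dt (I \<inter> {0..}) (eulerian G) x t
        = eulerian (\<lambda>a t. Gt a t - W a t * (Ga a t * inverse (J a t))) x t"
      unfolding dt_def
      by (rule vector_derivative_within[OF nontrivial_limit_forward[OF t]
          has_vector_derivative_at_within[OF has_partialsD(3)[OF e t(1),
            unfolded has_real_derivative_iff_has_vector_derivative]]])
    ultimately show ?thesis by (simp add: eulerian_def)
  qed
  show "dt (I \<inter> {0..}) (eulerian U) x t + eulerian W x t * dx (eulerian U) x t
      = 2 * eulerian Q x t * eulerian U x t"
    using transport[OF smooth(3) U_t[OF t(1)]] by (simp add: eulerian_def)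
  show "dt (I \<inter> {0..}) (eulerian Q) x t + eulerian W x t * dx (eulerian Q) x t
      = (eulerian Q x t)\<^sup>2 - \<sigma> * (eulerian U x t)\<^sup>2"
    using transport[OF smooth(2) Q_t[OF t(1)]] by (simp add: eulerian_def)
  obtain Wa Wt where hp: "has_partials I W Wa Wt" and sm: "smooth_on_strip I Wt"
    using smooth_has_partials[OF I(1) smooth_W] .
  have "Wa ?a t = 2 * Q ?a t * J ?a t"
    using has_partialsD(2)[OF hp t(1)] W_space_derivative[OF t(1)] by (rule DERIV_unique)
  moreover have "dx (eulerian W) x t = Wa ?a t * inverse (J ?a t)"
    unfolding dx_def using has_partialsD(2)[OF eulerian_partials[OF hp smooth_continuous[OF sm]] t(1)]
    by (intro DERIV_imp_deriv) (simp add: eulerian_def)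
  ultimately show "dx (eulerian W) x t = 2 * eulerian Q x t"
    using J_pos[OF t(1), of ?a] by (simp add: eulerian_def)
qed

end

section \<open>Uniqueness along the flow\<close>

text \<open>Gronwall's inequality for the supremum over an arbitrary index set, in a form that avoids regularity
  of that supremum in time: a bound \<open>E exp(2 C s)\<close> on all members improves, by integration of the
  inequality, to half of itself.\<close>
lemma gronwall_family:
  fixes d d' :: "'i \<Rightarrow> real \<Rightarrow> real"
  assumes C: "0 < C"
    and bound: "\<And>i s. i \<in> S \<Longrightarrow> s \<in> {0..T} \<Longrightarrow> \<bar>d i s\<bar> \<le> E"
    and init: "\<And>i. i \<in> S \<Longrightarrow> d i 0 = 0"
    and deriv: "\<And>i s. i \<in> S \<Longrightarrow> s \<in> {0..T} \<Longrightarrow>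
      ((\<lambda>s. d i s) has_real_derivative d' i s) (at s within {0..T})"
    and ineq: "\<And>s \<delta> i. s \<in> {0..T} \<Longrightarrow> (\<And>j. j \<in> S \<Longrightarrow> \<bar>d j s\<bar> \<le> \<delta>) \<Longrightarrow> i \<in> S \<Longrightarrow> \<bar>d' i s\<bar> \<le> C * \<delta>"
    and i: "i \<in> S" and s: "s \<in> {0..T}"
  shows "d i s = 0"
proof -
  have E: "0 \<le> E" using bound[OF i s] by linarith
  have iter: "\<bar>d i s\<bar> \<le> E / 2 ^ n * exp (2 * C * s)" if "i \<in> S" "s \<in> {0..T}" for n i s
    using that
  proof (induction n arbitrary: i s)
    case 0
    have "E * 1 \<le> E * exp (2 * C * s)"
      using 0 C E by (intro mult_left_mono) auto
    with bound[OF 0] show ?case by simp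
  next
    case (Suc n)
    let ?\<phi> = "\<lambda>r. E / 2 ^ Suc n * exp (2 * C * r)"
    show ?case
    proof (cases "s = 0")
      case True
      then show ?thesis using init[OF Suc.prems(1)] E by simp
    next
      case False
      with Suc.prems have "0 < s" by auto
      have sub: "{0..s} \<subseteq> {0..T}" using Suc.prems by auto
      have "norm (d i s - d i 0) \<le> ?\<phi> s - ?\<phi> 0"
      proof (rule differentiable_bound_general[OF \<open>0 < s\<close>])
        show "continuous_on {0..s} (\<lambda>r. d i r)"
          by (rule DERIV_continuous_on[where D = "\<lambda>r. d' i r"])
             (use deriv[OF Suc.prems(1)] sub DERIV_subset in blast)
        show "continuous_on {0..s} ?\<phi>" by (intro continuous_intros)
        fix r assume r: "0 < r" "r < s"
        then have rT: "r \<in> {0..T}" using sub by auto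
        have "at r within {0..T} = at r"
          by (rule at_within_interior) (use r Suc.prems in auto)
        then show "((\<lambda>r. d i r) has_vector_derivative d' i r) (at r)"
          using deriv[OF Suc.prems(1) rT] by (simp add: has_real_derivative_iff_has_vector_derivative)
        show "(?\<phi> has_vector_derivative C * (E / 2 ^ n * exp (2 * C * r))) (at r)"
          unfolding has_real_derivative_iff_has_vector_derivative[symmetric]
          by (auto intro!: derivative_eq_intros)
        show "norm (d' i r) \<le> C * (E / 2 ^ n * exp (2 * C * r))"
          using ineq[OF rT Suc.IH Suc.prems(1)] rT by simp
      qed
      moreover have "0 \<le> ?\<phi> 0" using E by simp
      ultimately show ?thesis using init[OF Suc.prems(1)] by simp
    qed
  qed
  have "(\<lambda>n. E * exp (2 * C * s) * (1 / 2) ^ n) \<longlonglongrightarrow> E * exp (2 * C * s) * 0"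
    by (intro tendsto_intros LIMSEQ_power_zero) simp
  then have "(\<lambda>n. E / 2 ^ n * exp (2 * C * s)) \<longlonglongrightarrow> 0"
    by (simp add: power_one_over field_simps)
  then have "\<bar>d i s\<bar> \<le> 0"
    using iter[OF i s] by (intro LIMSEQ_le_const) auto
  then show ?thesis by simp
qed

text \<open>Where the one-sided derivative in time is unique, the derivative operators agree with the family of
  partial derivatives.\<close>
lemma partials_of_dx_dt:
  assumes D: "partials_of K w D" and t: "t \<in> K" "at t within K \<noteq> bot"
  shows "((\<lambda>y. w y t) has_real_derivative dx w x t) (at x)"
    and "((\<lambda>s. w x s) has_real_derivative dt K w x t) (at t within K)"
    and "dx w x t = D 1 0 x t" and "dt K w x t = D 0 1 x t"
proof -
  have eq: "w y s = D 0 0 y s" if "s \<in> K" for y s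
    using D that unfolding partials_of_def by metis
  have "((\<lambda>y. D 0 0 y t) has_real_derivative D (Suc 0) 0 x t) (at x)"
    using D t(1) unfolding partials_of_def by blast
  then have x: "((\<lambda>y. w y t) has_real_derivative D 1 0 x t) (at x)"
    by (simp add: eq t(1))
  then show dx: "dx w x t = D 1 0 x t"
    unfolding dx_def by (rule DERIV_imp_deriv)
  have "((\<lambda>s. D 0 0 x s) has_real_derivative D 0 (Suc 0) x t) (at t within K)"
    using D t(1) unfolding partials_of_def by blast
  then have s: "((\<lambda>s. w x s) has_real_derivative D 0 1 x t) (at t within K)"
    unfolding One_nat_def by (rule has_field_derivative_transform_within[OF _ zero_less_one t(1)]) (simp add: eq)
  then show dt: "dt K w x t = D 0 1 x t"
    unfolding dt_def
    by (intro vector_derivative_within t(2)) (simp add: has_real_derivative_iff_has_vector_derivative)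
  show "((\<lambda>y. w y t) has_real_derivative dx w x t) (at x)"
    using x by (simp only: dx)
  show "((\<lambda>s. w x s) has_real_derivative dt K w x t) (at t within K)"
    using s by (simp only: dt)
qed

context lagrangian_solution
begin

text \<open>Along the explicit flow \<open>X\<close>, the differences \<open>d\<^sub>q = q(X, t) - Q\<close> and \<open>d\<^sub>u = u(X, t) - U\<close> vanish
  initially. Their time derivatives consist of polynomial terms, which are linear in \<open>d\<^sub>q\<close> and \<open>d\<^sub>u\<close> with
  bounded coefficients, and of \<open>(W - V(X, t)) q\<^sub>x\<close> or \<open>(W - V(X, t)) u\<^sub>x\<close>, which appear because the
  other solution is transported by \<open>V\<close> and not by the explicit velocity. The function \<open>W - V(X, t)\<close> is
  zero at label \<open>0\<close> and has label derivative \<open>-2 J d\<^sub>q\<close>; so on a bounded interval of labels around \<open>0\<close>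
  it is controlled by \<open>d\<^sub>q\<close> on the same interval, and Gronwall's inequality applies. Only compact sets
  are involved, so characteristics coming from infinity cannot interfere.\<close>
theorem classical_solution_along_flow:
  assumes sol: "classical_solution \<sigma> (\<lambda>x. U x 0) (\<lambda>x. Q x 0) (I \<inter> {0..}) u q V"
    and T: "T \<in> I" "0 \<le> T"
  shows "q (X a T) T = Q a T \<and> u (X a T) T = U a T"
proof -
  let ?K = "I \<inter> {0..}"
  obtain Dq Du DV where D: "partials_of ?K q Dq" "partials_of ?K u Du" "partials_of ?K V DV"
    using sol unfolding classical_solution_def smooth_decaying_on_strip_def smooth_on_strip_def by blast
  have nt: "at s within ?K \<noteq> bot" if "s \<in> ?K" for s
    using nontrivial_limit_forward that by auto
  have cK: "convex ?K" using I(2) by (intro convex_Int) auto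
  have seg: "{0..T} \<subseteq> ?K"
    using mem_is_interval_1_I[of I 0 T] I T by (auto simp: is_interval_convex_1)
  have pde: "dt ?K u x s + V x s * dx u x s = 2 * q x s * u x s"
    "dt ?K q x s + V x s * dx q x s = (q x s)\<^sup>2 - \<sigma> * (u x s)\<^sup>2"
    "dx V x s = 2 * q x s" "V 0 s = 0" if "s \<in> ?K" for x s
    using sol that unfolding classical_solution_def by blast+
  have init: "u x 0 = U x 0" "q x 0 = Q x 0" for x
    using sol unfolding classical_solution_def by auto
  have along: "((\<lambda>s. w (X b s) s - G b s) has_real_derivative dx w (X b s) s * W b s + dt ?K w (X b s) s - g)
      (at s within {0..T})"
    if P: "partials_of ?K w P" and s: "s \<in> {0..T}"
      and G: "((\<lambda>s. G b s) has_real_derivative g) (at s)" for w P G g b s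
  proof -
    have sK: "s \<in> ?K" and sI: "s \<in> I" using s seg by auto
    note dw = partials_of_dx_dt[OF P _ nt]
    have "continuous_on (UNIV \<times> ?K) (\<lambda>(x, t). P 0 1 x t)"
      using P by (auto simp: partials_of_def)
    then have "continuous_on (UNIV \<times> ?K) (\<lambda>(x, t). dt ?K w x t)"
      by (rule continuous_on_eq) (auto simp: dw(4))
    then have "((\<lambda>(y, s). w y s) has_derivative (\<lambda>(h, k). dx w (X b s) s * h + dt ?K w (X b s) s * k))
        (at (X b s, s) within UNIV \<times> ?K)"
      using dw(1,2) sK cK by (intro has_derivative_strip) blast+
    then have w: "((\<lambda>(y, s). w y s) has_derivative (\<lambda>(h, k). dx w (X b s) s * h + dt ?K w (X b s) s * k))
        (at (X b s, s) within (\<lambda>s. (X b s, s)) ` {0..T})"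
      by (rule has_derivative_subset) (use seg in auto)
    have "((\<lambda>s. X b s) has_derivative (*) (W b s)) (at s within {0..T})"
      using has_partialsD(3)[OF X_partials sI]
      by (auto simp: has_field_derivative_def intro: has_derivative_at_withinI)
    then have "((\<lambda>s. (X b s, s)) has_derivative (\<lambda>k. (W b s * k, k))) (at s within {0..T})"
      by (intro has_derivative_Pair) auto
    from has_derivative_in_compose[OF this w]
    have "((\<lambda>s. w (X b s) s) has_real_derivative dx w (X b s) s * W b s + dt ?K w (X b s) s)
        (at s within {0..T})"
      unfolding has_field_derivative_def
      by (auto simp: algebra_simps elim!: has_derivative_eq_rhs)
    then show ?thesis
      by (rule DERIV_diff[OF _ has_field_derivative_at_within[OF G]])
  qed
  define B where "B = \<bar>a\<bar> + 1"
  let ?S = "{- B..B}"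
  let ?C = "?S \<times> {0..T}"
  have "compact ?C" by (intro compact_Times) auto
  have bounded: "\<exists>M. \<forall>b\<in>?S. \<forall>s\<in>{0..T}. \<bar>h b s\<bar> \<le> M"
    if "continuous_on ?C (\<lambda>p. h (fst p) (snd p))" for h :: "real \<Rightarrow> real \<Rightarrow> real"
  proof -
    have "bounded ((\<lambda>p. h (fst p) (snd p)) ` ?C)"
      using compact_continuous_image[OF that \<open>compact ?C\<close>] by (rule compact_imp_bounded)
    then obtain M where "\<forall>p\<in>?C. norm (h (fst p) (snd p)) \<le> M"
      unfolding bounded_iff by auto
    then show ?thesis by (intro exI[of _ M]) auto
  qed
  have cX: "continuous_on ?C (\<lambda>p. X (fst p) (snd p))"
    by (rule continuous_on_strip_compose[OF has_partialsD(1)[OF X_partials]])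
       (use seg in \<open>auto intro!: continuous_intros\<close>)
  have cL: "continuous_on ?C (\<lambda>p. G (fst p) (snd p))" if "smooth_on_strip I G" for G
    by (rule continuous_on_strip_compose[OF smooth_continuous[OF that]])
       (use seg in \<open>auto intro!: continuous_intros\<close>)
  have cE: "continuous_on ?C (\<lambda>p. P i 0 (X (fst p) (snd p)) (snd p))" if "partials_of ?K w P" for w P i
  proof -
    have "continuous_on (UNIV \<times> ?K) (\<lambda>(x, t). P i 0 x t)"
      using that by (auto simp: partials_of_def)
    then show ?thesis
      by (rule continuous_on_strip_compose[OF _ cX]) (use seg in \<open>auto intro!: continuous_intros\<close>)
  qed
  obtain M1 where M1: "\<forall>b\<in>?S. \<forall>s\<in>{0..T}. \<bar>Q b s\<bar> \<le> M1"
    using bounded[OF cL[OF smooth(2)]] by blast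
  obtain M2 where M2: "\<forall>b\<in>?S. \<forall>s\<in>{0..T}. \<bar>U b s\<bar> \<le> M2"
    using bounded[OF cL[OF smooth(3)]] by blast
  obtain M3 where M3: "\<forall>b\<in>?S. \<forall>s\<in>{0..T}. \<bar>J b s\<bar> \<le> M3"
    using bounded[OF cL[OF smooth(1)]] by blast
  obtain M4 where M4: "\<forall>b\<in>?S. \<forall>s\<in>{0..T}. \<bar>Dq 0 0 (X b s) s\<bar> \<le> M4"
    using bounded[OF cE[OF D(1), of 0]] by blast
  obtain M5 where M5: "\<forall>b\<in>?S. \<forall>s\<in>{0..T}. \<bar>Du 0 0 (X b s) s\<bar> \<le> M5"
    using bounded[OF cE[OF D(2), of 0]] by blast
  obtain M6 where M6: "\<forall>b\<in>?S. \<forall>s\<in>{0..T}. \<bar>Dq 1 0 (X b s) s\<bar> \<le> M6"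
    using bounded[OF cE[OF D(1), of 1]] by blast
  obtain M7 where M7: "\<forall>b\<in>?S. \<forall>s\<in>{0..T}. \<bar>Du 1 0 (X b s) s\<bar> \<le> M7"
    using bounded[OF cE[OF D(2), of 1]] by blast
  note Ms = M1[rule_format] M2[rule_format] M3[rule_format] M4[rule_format] M5[rule_format] M6[rule_format] M7[rule_format]
  define M where "M = Max {1, M1, M2, M3, M4, M5, M6, M7}"
  have Mge: "1 \<le> M" "M1 \<le> M" "M2 \<le> M" "M3 \<le> M" "M4 \<le> M" "M5 \<le> M" "M6 \<le> M" "M7 \<le> M"
    unfolding M_def by (intro Max_ge; simp)+
  then have M: "0 < M" by linarith
  have bd: "\<bar>Q b s\<bar> \<le> M" "\<bar>U b s\<bar> \<le> M" "\<bar>J b s\<bar> \<le> M" "\<bar>q (X b s) s\<bar> \<le> M" "\<bar>u (X b s) s\<bar> \<le> M"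
    "\<bar>dx q (X b s) s\<bar> \<le> M" "\<bar>dx u (X b s) s\<bar> \<le> M" if b: "b \<in> ?S" and s: "s \<in> {0..T}" for b s
  proof -
    have sK: "s \<in> ?K" using s seg by auto
    have "q (X b s) s = Dq 0 0 (X b s) s" "u (X b s) s = Du 0 0 (X b s) s"
      using D(1,2) sK unfolding partials_of_def by auto
    moreover have "dx q (X b s) s = Dq 1 0 (X b s) s" "dx u (X b s) s = Du 1 0 (X b s) s"
      by (rule partials_of_dx_dt(3)[OF D(1) sK nt[OF sK]], rule partials_of_dx_dt(3)[OF D(2) sK nt[OF sK]])
    ultimately show "\<bar>Q b s\<bar> \<le> M" "\<bar>U b s\<bar> \<le> M" "\<bar>J b s\<bar> \<le> M" "\<bar>q (X b s) s\<bar> \<le> M" "\<bar>u (X b s) s\<bar> \<le> M"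
      "\<bar>dx q (X b s) s\<bar> \<le> M" "\<bar>dx u (X b s) s\<bar> \<le> M"
      using Ms[OF b s] Mge by simp_all
  qed
  define dq where "dq b s = q (X b s) s - Q b s" for b s
  define du where "du b s = u (X b s) s - U b s" for b s
  have velocity: "\<bar>W b s - V (X b s) s\<bar> \<le> 2 * M * \<delta> * B"
    if s: "s \<in> {0..T}" and \<delta>: "\<And>b. b \<in> ?S \<Longrightarrow> \<bar>dq b s\<bar> \<le> \<delta>" and b: "b \<in> ?S" for b s \<delta>
  proof -
    have sK: "s \<in> ?K" and sI: "s \<in> I" using s seg by auto
    let ?g = "\<lambda>b. W b s - V (X b s) s"
    have "0 \<le> \<delta>" using \<delta>[OF b] by linarith
    have "norm (?g b - ?g 0) \<le> 2 * M * \<delta> * norm (b - 0)"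
    proof (rule field_differentiable_bound[where S = "?S"])
      fix z assume z: "z \<in> ?S"
      have "((\<lambda>b. V (X b s) s) has_field_derivative 2 * q (X z s) s * J z s) (at z)"
        using partials_of_dx_dt(1)[OF D(3) sK nt[OF sK], of "X z s"] pde(3)[OF sK]
        by (intro DERIV_chain2[OF _ has_partialsD(2)[OF X_partials sI]]) simp
      from DERIV_diff[OF W_space_derivative[OF sI] this]
      show "(?g has_field_derivative 2 * Q z s * J z s - 2 * q (X z s) s * J z s) (at z within ?S)"
        by (rule has_field_derivative_at_within)
      have "2 * Q z s * J z s - 2 * q (X z s) s * J z s = - (2 * (J z s * dq z s))"
        by (simp add: dq_def algebra_simps)
      moreover have "\<bar>J z s * dq z s\<bar> \<le> M * \<delta>"
        unfolding abs_mult using bd(3)[OF z s] \<delta>[OF z] M by (intro mult_mono) auto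
      ultimately show "norm (2 * Q z s * J z s - 2 * q (X z s) s * J z s) \<le> 2 * M * \<delta>"
        by simp
    qed (use b in \<open>auto simp: B_def\<close>)
    also have "\<dots> \<le> 2 * M * \<delta> * B"
      using b M \<open>0 \<le> \<delta>\<close> by (intro mult_left_mono) auto
    finally show ?thesis by (simp add: X_0 W_0 pde(4)[OF sK])
  qed
  \<comment> \<open>The Boolean component of the index selects the difference in \<open>q\<close> or in \<open>u\<close>, so that both enter one
    family; \<open>d'\<close> is its time derivative.\<close>
  define d where "d p = (if fst p then dq (snd p) else du (snd p))" for p :: "bool \<times> real"
  define d' where "d' p s = (let b = snd p in
      (W b s - V (X b s) s) * (if fst p then dx q (X b s) s else dx u (X b s) s) +
      (if fst p then (q (X b s) s + Q b s) * dq b s - \<sigma> * ((u (X b s) s + U b s) * du b s)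
       else 2 * q (X b s) s * du b s + 2 * U b s * dq b s))" for p :: "bool \<times> real" and s
  \<comment> \<open>The summands bound the transport term, \<open>q\<^sup>2 - Q\<^sup>2\<close>, \<open>\<sigma> (u\<^sup>2 - U\<^sup>2)\<close> and \<open>2 (q u - Q U)\<close>.\<close>
  define C where "C = 2 * M * B * M + 2 * M + \<bar>\<sigma>\<bar> * (2 * M) + 4 * M"
  have zero: "d p s = 0" if "p \<in> UNIV \<times> ?S" "s \<in> {0..T}" for p s
  proof (rule gronwall_family[where d = d and d' = d' and C = C and E = "2 * M" and T = T, OF _ _ _ _ _ that])
    show "0 < C"
      unfolding C_def B_def using M by (intro add_nonneg_pos add_nonneg_nonneg) auto
  next
    fix p :: "bool \<times> real" and s assume p: "p \<in> UNIV \<times> ?S" and s: "s \<in> {0..T}"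
    let ?b = "snd p"
    have b: "?b \<in> ?S" and sK: "s \<in> ?K" and sI: "s \<in> I" using p s seg by (auto simp: mem_Times_iff)
    show "\<bar>d p s\<bar> \<le> 2 * M"
      using bd[OF b s] by (auto simp: d_def dq_def du_def)
    have "((\<lambda>s. dq ?b s) has_real_derivative d' (True, ?b) s) (at s within {0..T})"
      unfolding dq_def
    proof (rule DERIV_cong[OF along[OF D(1) s Q_t[OF sI]]])
      show "dx q (X ?b s) s * W ?b s + dt ?K q (X ?b s) s - ((Q ?b s)\<^sup>2 - \<sigma> * (U ?b s)\<^sup>2) = d' (True, ?b) s"
        using pde(2)[OF sK, of "X ?b s"]
        by (simp add: d'_def dq_def du_def Let_def algebra_simps power2_eq_square)
    qed
    moreover have "((\<lambda>s. du ?b s) has_real_derivative d' (False, ?b) s) (at s within {0..T})"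
      unfolding du_def
    proof (rule DERIV_cong[OF along[OF D(2) s U_t[OF sI]]])
      show "dx u (X ?b s) s * W ?b s + dt ?K u (X ?b s) s - 2 * Q ?b s * U ?b s = d' (False, ?b) s"
        using pde(1)[OF sK, of "X ?b s"]
        by (simp add: d'_def dq_def du_def Let_def algebra_simps power2_eq_square)
    qed
    ultimately show "((\<lambda>s. d p s) has_real_derivative d' p s) (at s within {0..T})"
      by (cases p) (auto simp: d_def)
    fix \<delta> assume \<delta>: "\<And>j. j \<in> UNIV \<times> ?S \<Longrightarrow> \<bar>d j s\<bar> \<le> \<delta>"
    have dl: "\<bar>dq b s\<bar> \<le> \<delta>" "\<bar>du b s\<bar> \<le> \<delta>" if "b \<in> ?S" for b
      using \<delta>[of "(True, b)"] \<delta>[of "(False, b)"] that by (auto simp: d_def)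
    have m: "\<bar>x * y\<bar> \<le> k * l" if "\<bar>x\<bar> \<le> k" "\<bar>y\<bar> \<le> l" for x y k l :: real
      unfolding abs_mult using that by (intro mult_mono) auto
    note e = bd[OF b s] and dlb = dl[OF b]
    have v: "\<bar>(W ?b s - V (X ?b s) s) * (if fst p then dx q (X ?b s) s else dx u (X ?b s) s)\<bar>
        \<le> 2 * M * \<delta> * B * M"
      by (rule m[OF velocity[OF s dl(1) b]]) (use e in auto)
    have f1: "\<bar>(q (X ?b s) s + Q ?b s) * dq ?b s\<bar> \<le> 2 * M * \<delta>"
      by (rule m) (use e dlb in linarith)+
    have f2: "\<bar>\<sigma> * ((u (X ?b s) s + U ?b s) * du ?b s)\<bar> \<le> \<bar>\<sigma>\<bar> * (2 * M * \<delta>)"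
      by (rule m[OF order.refl m]) (use e dlb in linarith)+
    have f3: "\<bar>2 * q (X ?b s) s * du ?b s\<bar> \<le> 2 * M * \<delta>" "\<bar>2 * U ?b s * dq ?b s\<bar> \<le> 2 * M * \<delta>"
      by (rule m; use e dlb in linarith)+
    have "0 \<le> M * \<delta>" using m[OF e(1) dlb(1)] by linarith
    then have pos: "0 \<le> 2 * M * \<delta>" "0 \<le> \<bar>\<sigma>\<bar> * (2 * M * \<delta>)" by auto
    have tri: "\<bar>x + (if P then y - z else w + v)\<bar> \<le> k + e + f + 2 * e"
      if "\<bar>x\<bar> \<le> k" "\<bar>y\<bar> \<le> e" "\<bar>z\<bar> \<le> f" "\<bar>w\<bar> \<le> e" "\<bar>v\<bar> \<le> e" "0 \<le> e" "0 \<le> f"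
      for P and x y z w v k e f :: real
      using that by (cases P) auto
    have "\<bar>d' p s\<bar> \<le> 2 * M * \<delta> * B * M + 2 * M * \<delta> + \<bar>\<sigma>\<bar> * (2 * M * \<delta>) + 2 * (2 * M * \<delta>)"
      unfolding d'_def Let_def by (rule tri[OF v f1 f2 f3 pos])
    also have "\<dots> = C * \<delta>" by (simp add: C_def algebra_simps)
    finally show "\<bar>d' p s\<bar> \<le> C * \<delta>" .
  next
    show "d p 0 = 0" for p
      by (simp add: d_def dq_def du_def X_init init)
  qed
  have "a \<in> ?S" by (auto simp: B_def)
  then show ?thesis
    using zero[of "(True, a)" T] zero[of "(False, a)" T] T
    by (simp add: d_def dq_def du_def)
qed

end

section \<open>The two couplings\<close>

text \<open>Boundedness is what makes the real-valued supremum in \<open>sup_norm\<close> an upper bound.\<close>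
lemma abs_bdd_above_of_decay:
  fixes g :: "real \<Rightarrow> real"
  assumes g: "continuous_on UNIV g" "(g \<longlongrightarrow> 0) at_infinity"
  shows "bdd_above (range (\<lambda>x. \<bar>g x\<bar>))"
proof -
  have "\<forall>\<^sub>F x in at_infinity. \<bar>g x\<bar> < 1"
    using tendstoD[OF g(2), of 1] by (simp add: dist_real_def)
  then obtain b where b: "\<And>x. b \<le> norm x \<Longrightarrow> \<bar>g x\<bar> < 1"
    unfolding eventually_at_infinity by blast
  have "bounded (g ` cball 0 b)"
    using g(1) by (intro compact_imp_bounded compact_continuous_image) (auto intro: continuous_on_subset)
  then obtain k where "\<forall>x\<in>cball 0 b. \<bar>g x\<bar> \<le> k"
    unfolding bounded_iff by auto
  then have k: "\<bar>g x\<bar> \<le> k" if "norm x \<le> b" for x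
    using that mem_cball_0 by blast
  have "\<bar>g x\<bar> \<le> max 1 k" for x
    using b[of x] k[of x] by (cases "b \<le> norm x") (auto simp: max_def)
  then show ?thesis by (intro bdd_aboveI2)
qed

lemma classical_solution_combination_bdd_above:
  assumes "classical_solution \<sigma> u0 q0 I u q V" "t \<in> I"
  shows "bdd_above (range (\<lambda>x. \<bar>q x t + k * u x t\<bar>))"
proof (rule abs_bdd_above_of_decay)
  obtain Dq Du where D: "partials_of I q Dq" "partials_of I u Du"
    and lim: "((\<lambda>x. Dq 0 0 x t) \<longlongrightarrow> 0) at_infinity" "((\<lambda>x. Du 0 0 x t) \<longlongrightarrow> 0) at_infinity"
    using assms unfolding classical_solution_def smooth_decaying_on_strip_def by blast
  have eq: "Dq 0 0 x t = q x t" "Du 0 0 x t = u x t" for x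
    using D assms(2) unfolding partials_of_def by auto
  have "((\<lambda>x. q x t + k * u x t) \<longlongrightarrow> 0 + k * 0) at_infinity"
    using lim unfolding eq by (intro tendsto_intros)
  then show "((\<lambda>x. q x t + k * u x t) \<longlongrightarrow> 0) at_infinity" by simp
  have c: "continuous_on (UNIV \<times> I) (\<lambda>(x, t). Dq 0 0 x t)" "continuous_on (UNIV \<times> I) (\<lambda>(x, t). Du 0 0 x t)"
    using D unfolding partials_of_def by auto
  have "continuous_on UNIV (\<lambda>x. Dq 0 0 x t + k * Du 0 0 x t)"
    by (intro continuous_intros continuous_on_strip_compose[OF c(1)] continuous_on_strip_compose[OF c(2)] assms(2))
  then show "continuous_on UNIV (\<lambda>x. q x t + k * u x t)" by (simp add: eq)
qed

lemma test_function_vanishes_outside: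
  assumes "test_function f"
  obtains R where "\<And>x. R < \<bar>x\<bar> \<Longrightarrow> f x = 0"
proof -
  have "bounded (closure {x. f x \<noteq> 0})"
    using assms compact_imp_bounded by (auto simp: test_function_def)
  then obtain R where "\<forall>x\<in>closure {x. f x \<noteq> 0}. norm x \<le> R"
    unfolding bounded_iff by blast
  then have "f x = 0" if "R < \<bar>x\<bar>" for x
    using that closure_subset[of "{x. f x \<noteq> 0}"] by force
  then show thesis by (rule that)
qed

lemma test_function_attains_sup_norm:
  assumes f: "test_function f" "\<And>x. 0 \<le> f x" "\<exists>x. f x \<noteq> 0"
  obtains x0 where "f x0 = sup_norm f" "\<And>x. f x \<le> f x0" "0 < f x0"
proof -
  let ?S = "closure {x. f x \<noteq> 0}"
  have "(deriv ^^ 0) f differentiable (at x)" for x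
    using f(1) unfolding test_function_def by blast
  then have "continuous_on ?S f"
    by (intro continuous_at_imp_continuous_on) (auto intro: differentiable_imp_continuous_within)
  moreover have "compact ?S" "?S \<noteq> {}"
    using f by (auto simp: test_function_def)
  ultimately obtain x0 where x0: "\<And>x. x \<in> ?S \<Longrightarrow> f x \<le> f x0"
    using continuous_attains_sup[of ?S f] by blast
  have le: "f x \<le> f x0" for x
  proof (cases "f x = 0")
    case False
    then have "x \<in> {x. f x \<noteq> 0}" by simp
    then show ?thesis by (intro x0 subsetD[OF closure_subset])
  qed (simp add: f(2))
  have "sup_norm f = f x0"
    unfolding sup_norm_def using f(2) le by (intro cSup_eq_maximum) auto
  obtain y where "f y \<noteq> 0" using f(3) by blast
  then have "0 < f x0"
    using f(2)[of y] le[of y] by linarith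
  with le \<open>sup_norm f = f x0\<close> show thesis
    by (intro that[of x0]) auto
qed

text \<open>Real and imaginary part of the complex Riccati solution \<open>Z\<^sub>0 / (1 - Z\<^sub>0 t)\<close> with
  \<open>Z\<^sub>0 = (1 + i) c f\<close>, where \<open>D = \<bar>1 - Z\<^sub>0 t\<bar>\<^sup>2\<close>, solve the label equations for all real times.\<close>
theorem global_solution_positive_coupling:
  fixes f :: "real \<Rightarrow> real" and c :: real
  assumes f: "test_function f"
  shows "\<exists>u q V. global_classical_solution (c\<^sup>2) f (\<lambda>x. c * f x) u q V"
proof -
  obtain R where R: "\<And>x. R < \<bar>x\<bar> \<Longrightarrow> f x = 0"
    using test_function_vanishes_outside[OF f] by blast
  define D where "D a t = (1 - c * f a * t)\<^sup>2 + (c * f a * t)\<^sup>2" for a t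
  define J where "J a t = inverse (D a t)" for a t
  define Q where "Q a t = (c * f a - 2 * (c * f a)\<^sup>2 * t) * inverse (D a t)" for a t
  define U where "U a t = f a * inverse (D a t)" for a t
  have D_pos: "0 < D a t" for a t
    unfolding D_def by (cases "c * f a * t = 0") (auto intro: add_nonneg_pos)
  have sf: "smooth_on_strip UNIV (\<lambda>a t. f a)"
    using f by (intro smooth_space) (simp add: test_function_def)
  note ou = open_UNIV convex_UNIV
  note sm = smooth_mult[OF ou] smooth_add[OF ou] smooth_diff[OF ou] smooth_const smooth_time sf
  have sD: "smooth_on_strip UNIV D"
    unfolding D_def[abs_def] power2_eq_square by (intro sm)
  have sDi: "smooth_on_strip UNIV (\<lambda>a t. inverse (D a t))"
    using D_pos by (intro smooth_inverse[OF ou sD]) (metis less_irrefl)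
  have D_t: "((\<lambda>s. D a s) has_real_derivative - 2 * (c * f a - 2 * (c * f a)\<^sup>2 * t)) (at t)" for a t
    unfolding D_def by (auto intro!: derivative_eq_intros simp: power2_eq_square algebra_simps)
  have Di_t: "((\<lambda>s. inverse (D a s)) has_real_derivative
      2 * (c * f a - 2 * (c * f a)\<^sup>2 * t) * inverse (D a t) * inverse (D a t)) (at t)" for a t
    by (rule DERIV_cong[OF DERIV_inverse_fun[OF D_t]])
       (use D_pos[of a t] in \<open>simp_all add: algebra_simps\<close>)
  interpret lagrangian_solution UNIV "c\<^sup>2" R J Q U
  proof
    show "smooth_on_strip UNIV J" "smooth_on_strip UNIV U"
      unfolding J_def[abs_def] U_def[abs_def] by (intro sm sDi)+
    show "smooth_on_strip UNIV Q"
      unfolding Q_def[abs_def] power2_eq_square by (intro sm sDi)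
    fix a t
    show "0 < J a t" using D_pos by (simp add: J_def)
    show "((\<lambda>s. J a s) has_real_derivative 2 * Q a t * J a t) (at t)"
      unfolding J_def Q_def by (rule DERIV_cong[OF Di_t]) (simp add: algebra_simps)
    show "((\<lambda>s. U a s) has_real_derivative 2 * Q a t * U a t) (at t)"
      unfolding U_def Q_def by (rule DERIV_cong[OF DERIV_cmult[OF Di_t]]) (simp add: algebra_simps)
    have "((\<lambda>s. Q a s) has_real_derivative - 2 * (c * f a)\<^sup>2 * inverse (D a t) +
        2 * (c * f a - 2 * (c * f a)\<^sup>2 * t) * inverse (D a t) * inverse (D a t) * (c * f a - 2 * (c * f a)\<^sup>2 * t)) (at t)"
      unfolding Q_def by (rule DERIV_mult[THEN DERIV_cong, OF _ Di_t])
        (auto intro!: derivative_eq_intros)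
    moreover have "- 2 * (c * f a)\<^sup>2 * inverse (D a t) +
        2 * (c * f a - 2 * (c * f a)\<^sup>2 * t) * inverse (D a t) * inverse (D a t) * (c * f a - 2 * (c * f a)\<^sup>2 * t)
        = (Q a t)\<^sup>2 - c\<^sup>2 * (U a t)\<^sup>2"
    proof -
      have "D a t * inverse (D a t) = 1" using D_pos[of a t] by simp
      then show ?thesis
        unfolding Q_def U_def using D_def[of a t] by algebra
    qed
    ultimately show "((\<lambda>s. Q a s) has_real_derivative (Q a t)\<^sup>2 - c\<^sup>2 * (U a t)\<^sup>2) (at t)"
      by (rule DERIV_cong)
    show "J a 0 = 1" by (simp add: J_def D_def)
    show "J a t = 1 \<and> Q a t = 0 \<and> U a t = 0" if "R < \<bar>a\<bar>"
      using R[OF that] by (simp add: J_def Q_def U_def D_def)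
  qed auto
  have "(\<lambda>x. U x 0) = f" "(\<lambda>x. Q x 0) = (\<lambda>x. c * f x)"
    by (auto simp: U_def Q_def D_def)
  then have "global_classical_solution (c\<^sup>2) f (\<lambda>x. c * f x) (eulerian U) (eulerian Q) (eulerian W)"
    using classical_solution_eulerian by (simp add: global_classical_solution_def)
  then show ?thesis by blast
qed

text \<open>Here \<open>Q = c U\<close>, and \<open>Q + c U\<close> solves the real Riccati equation at each label. Before the time \<open>T\<close> no
  denominator \<open>1 - 2 c f t\<close> vanishes, which gives existence. At a maximum point \<open>x\<^sub>0\<close> of \<open>f\<close> the
  denominator is \<open>2 c f(x\<^sub>0) (T - t)\<close>; hence \<open>q + c u\<close> takes the value \<open>1 / (T - t)\<close> in every classical
  solution, and the norm diverges.\<close>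
theorem blow_up_negative_coupling:
  fixes f :: "real \<Rightarrow> real" and c :: real
  assumes f: "test_function f" "\<And>x. 0 \<le> f x" "\<exists>x. f x \<noteq> 0" and c: "0 < c"
  shows "blows_up_at c (- (c\<^sup>2)) f (\<lambda>x. c * f x) (1 / (2 * c * sup_norm f))"
proof -
  obtain R where R: "\<And>x. R < \<bar>x\<bar> \<Longrightarrow> f x = 0"
    using test_function_vanishes_outside[OF f(1)] by blast
  obtain x0 where x0: "f x0 = sup_norm f" "\<And>x. f x \<le> f x0" "0 < f x0"
    using test_function_attains_sup_norm[OF f] by blast
  define T where "T = 1 / (2 * c * f x0)"
  have T: "0 < T" using c x0(3) by (simp add: T_def)
  define I where "I = {..<T}"
  define D where "D a t = 1 - 2 * c * f a * t" for a t
  define J where "J a t = inverse (D a t)" for a t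
  define Q where "Q a t = c * f a * inverse (D a t)" for a t
  define U where "U a t = f a * inverse (D a t)" for a t
  have D_pos: "0 < D a t" if "t \<in> I" for a t
  proof (cases "0 \<le> t")
    case True
    have "2 * c * f a * t \<le> 2 * c * f x0 * t"
      using c x0(2)[of a] True by (intro mult_right_mono) auto
    also have "\<dots> < 2 * c * f x0 * T"
      using that c x0(3) by (intro mult_strict_left_mono) (auto simp: I_def)
    also have "\<dots> = 1" using c x0(3) by (simp add: T_def)
    finally show ?thesis by (simp add: D_def)
  next
    case False
    then have "2 * c * f a * t \<le> 0"
      using c f(2)[of a] by (intro mult_nonneg_nonpos) auto
    then show ?thesis unfolding D_def by linarith
  qed
  have sf: "smooth_on_strip I (\<lambda>a t. f a)"
    using f(1) by (intro smooth_space) (simp add: test_function_def)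
  have oI: "open I" "convex I" by (auto simp: I_def)
  note sm = smooth_mult[OF oI] smooth_diff[OF oI] smooth_const smooth_time sf
  have sD: "smooth_on_strip I D"
    unfolding D_def[abs_def] by (intro sm)
  have sDi: "smooth_on_strip I (\<lambda>a t. inverse (D a t))"
    using D_pos by (intro smooth_inverse[OF oI sD]) (metis less_irrefl)
  have D_t: "((\<lambda>s. D a s) has_real_derivative - (2 * c * f a)) (at t)" for a t
    unfolding D_def by (auto intro!: derivative_eq_intros)
  have Di_t: "((\<lambda>s. inverse (D a s)) has_real_derivative 2 * c * f a * inverse (D a t) * inverse (D a t)) (at t)"
    if "t \<in> I" for a t
    by (rule DERIV_cong[OF DERIV_inverse_fun[OF D_t]])
       (use D_pos[OF that, of a] in \<open>simp_all add: algebra_simps\<close>)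
  interpret lagrangian_solution I "- (c\<^sup>2)" R J Q U
  proof
    show "0 \<in> I" using T by (simp add: I_def)
    show "smooth_on_strip I J" "smooth_on_strip I U" "smooth_on_strip I Q"
      unfolding J_def[abs_def] U_def[abs_def] Q_def[abs_def] by (intro sm sDi)+
    show "J a 0 = 1" for a by (simp add: J_def D_def)
    fix a t assume t: "t \<in> I"
    show "0 < J a t" using D_pos[OF t] by (simp add: J_def)
    show "((\<lambda>s. J a s) has_real_derivative 2 * Q a t * J a t) (at t)"
      using Di_t[OF t, of a] by (simp add: J_def Q_def mult_ac)
    show "((\<lambda>s. U a s) has_real_derivative 2 * Q a t * U a t) (at t)"
      using DERIV_cmult[OF Di_t[OF t, of a], of "f a"] by (simp add: U_def Q_def mult_ac)
    show "((\<lambda>s. Q a s) has_real_derivative (Q a t)\<^sup>2 - - (c\<^sup>2) * (U a t)\<^sup>2) (at t)"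
      using DERIV_cmult[OF Di_t[OF t, of a], of "c * f a"]
      by (simp add: U_def Q_def power2_eq_square mult_ac)
    show "J a t = 1 \<and> Q a t = 0 \<and> U a t = 0" if "R < \<bar>a\<bar>"
      using R[OF that] by (simp add: J_def Q_def U_def D_def)
  qed (fact oI)+
  have init: "(\<lambda>x. U x 0) = f" "(\<lambda>x. Q x 0) = (\<lambda>x. c * f x)"
    by (auto simp: U_def Q_def D_def)
  have K: "I \<inter> {0..} = {0..<T}" by (auto simp: I_def)
  have T_eq: "1 / (2 * c * sup_norm f) = T" by (simp add: T_def x0(1))
  have "filterlim (\<lambda>t. sup_norm (\<lambda>x. q x t + c * u x t) + sup_norm (\<lambda>x. q x t - c * u x t)) at_top (at_left T)"
    if sol: "classical_solution (- (c\<^sup>2)) f (\<lambda>x. c * f x) {0..<T} u q V" for u q V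
  proof (rule filterlim_at_top_mono)
    have "((\<lambda>t. T - t) \<longlongrightarrow> T - T) (at_left T)" by (intro tendsto_intros)
    then show "filterlim (\<lambda>t. inverse (T - t)) at_top (at_left T)"
      by (intro filterlim_inverse_at_top) (auto simp: eventually_at_filter)
    have "inverse (T - t) \<le> sup_norm (\<lambda>x. q x t + c * u x t) + sup_norm (\<lambda>x. q x t - c * u x t)"
      if t: "t \<in> {0<..<T}" for t
    proof -
      have tK: "t \<in> {0..<T}" and tI: "t \<in> I" using t by (auto simp: I_def)
      have *: "\<bar>q x t + k * u x t\<bar> \<le> sup_norm (\<lambda>x. q x t + k * u x t)" for x k
        unfolding sup_norm_def
        by (intro cSUP_upper classical_solution_combination_bdd_above[OF sol tK]) auto
      have "q (X x0 t) t = Q x0 t \<and> u (X x0 t) t = U x0 t"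
        using classical_solution_along_flow[of u q V t x0] sol tI tK unfolding init K by auto
      moreover have "Q x0 t + c * U x0 t = inverse (T - t)"
      proof -
        have "D x0 t = 2 * c * f x0 * (T - t)"
          using c x0(3) by (simp add: D_def T_def field_simps)
        moreover have "Q x0 t + c * U x0 t = 2 * c * f x0 * inverse (D x0 t)"
          by (simp add: Q_def U_def)
        ultimately show ?thesis
          using c x0(3) t by (simp add: divide_simps)
      qed
      ultimately have "inverse (T - t) \<le> sup_norm (\<lambda>x. q x t + c * u x t)"
        using order.trans[OF abs_ge_self *[of "X x0 t" c]] by simp
      moreover have "0 \<le> sup_norm (\<lambda>x. q x t - c * u x t)"
        using *[of 0 "- c"] by simp
      ultimately show ?thesis by simp
    qed
    then show "\<forall>\<^sub>F t in at_left T. inverse (T - t) \<le>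
        sup_norm (\<lambda>x. q x t + c * u x t) + sup_norm (\<lambda>x. q x t - c * u x t)"
      using eventually_at_left_real[OF T] by (rule eventually_mono[rotated])
  qed
  moreover have "classical_solution (- (c\<^sup>2)) f (\<lambda>x. c * f x) {0..<T} (eulerian U) (eulerian Q) (eulerian W)"
    using classical_solution_eulerian unfolding init K .
  ultimately show ?thesis
    unfolding blows_up_at_def T_eq using T by blast
qed

theorem corollary3p3:
  fixes f :: "real \<Rightarrow> real" and c :: real
  assumes "test_function f"
    and "\<And>x. 0 \<le> f x"
    and "\<exists>x. f x \<noteq> 0"
    and "0 < c"
  shows "(\<exists>u q V. global_classical_solution (c\<^sup>2) f (\<lambda>x. c * f x) u q V) \<and>
         blows_up_at c (- (c\<^sup>2)) f (\<lambda>x. c * f x) (1 / (2 * c * sup_norm f))"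
  using global_solution_positive_coupling[OF assms(1)] blow_up_negative_coupling[OF assms] by blast

end
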